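(* Let $n \in \mathbb{Z}^+$, let $M^n$ be a closed, smooth manifold of dimension $n$, and let $f: M \to M$ be a self-diffeomorphism of $M$. Then $f = \Phi_1$, where $\Phi_t$ is the flow of some differential equation (smooth vector field) on $M$, if and only if $f$ is smoothly rootable to the identity. In this case, for any smooth root system to the identity $(g_b)_{b \in \mathbb{Z}^+}$ for $f$, with corresponding flow $\Psi_t: M \times \mathbb{R} \to M$ (the unique continuous extension to $M\times\mathbb{R}$ of the map $M \times \mathbb{Q} \to M$, $(p, \frac{a}{b}) \mapsto (g_b)^a(p)$), the differential equation $\xi$ on $M$ inducing $\Psi_t$ is given by $$\xi = \frac{\partial}{\partial t}\left\{\Psi_t\right\}\Big|_{t=0}.$$
   Context: A differential equation on a smooth manifold $M$ is a (time-independent) smooth tangent vector field, i.e. a smooth map $\xi: M \to TM$ with $\pi_M \circ \xi = \mathrm{id}_M$. On a closed manifold every such $\xi$ is complete, so it has a flow $\Phi: M \times \mathbb{R} \to M$, written $\Phi_t(p) = \Phi(p,t)$; $\Phi_1$ is its time-1 map. A vector field $\xi$ induces $\Psi_t$ if $\Psi_t$ is the flow of $\xi$. Let $f: M \to M$ be a self-diffeomorphism of a smooth manifold $M$. Powers $(g)^a$ with $a \in \mathbb{Z}$ denote iterated composition (of the inverse if $a<0$, and the identity if $a=0$), and $\mathrm{GCD}(a,b)$ is the positive greatest common divisor (so $\mathrm{GCD}(0,b)=b$ for $b \in \mathbb{Z}^+$). We say $f$ is rootable to the identity if $f$ is isotopic to the identity and there is a sequence $(g_b)_{b \in \mathbb{Z}^+}$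 of self-diffeomorphisms of $M$ such that: 1) each $g_b$ is isotopic to the identity; 2) $(g_b)^b = f$ for all $b \in \mathbb{Z}^+$; 3) (commutativity condition) for all $b_1, b_2 \in \mathbb{Z}^+$ and $p\in M$, $g_{b_1}(g_{b_2}(p)) = (g_{b_1 b_2})^{b_1+b_2}(p) = g_{b_2}(g_{b_1}(p))$; 4) (coherency condition) for all $a \in \mathbb{Z}$ and $b \in \mathbb{Z}^+$, $(g_b)^a = \left(g_{\frac{b}{\mathrm{GCD}(a,b)}}\right)^{\frac{a}{\mathrm{GCD}(a,b)}}$; 5) $\lim_{b \to \infty} g_b = \mathrm{id}_M$, i.e. $\lim_{b\to\infty} g_b(p) = p$ for every $p \in M$. Such a sequence $(g_b)$ is called a root system to the identity (for $f$). Given a root system to the identity, define $\Phi_{\frac{a}{b}}: M \times \mathbb{Q} \to M$ by $\Phi_{\frac{a}{b}}(p) = (g_b)^a(p)$ for $a \in \mathbb{Z}$, $b \in \mathbb{Z}^+$ (well defined by the coherency condition). We say $f$ is continuously rootable to the identity, and call $(g_b)$ a continuous root system to the identity, if this map extends to a continuous function $\Phi_t: M \times \mathbb{R} \to M$ (such an extension is unique if it exists). We say $f$ is smoothly rootable to the identity, and call $(g_b)$ a smooth root system to the identity, if moreover this extension $\Phi_t: M \times \mathbb{R} \to M$ is smooth. *)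

theory Defs
  imports "HOL-Analysis.Analysis"
begin

section \<open>Smooth maps between open subsets of Euclidean spaces\<close>

text \<open>Only meaningful on open sets \<open>S\<close>, since derivatives are taken with respect to
  full neighbourhoods.\<close>

fun Ck_on :: "nat \<Rightarrow> 'd::euclidean_space set \<Rightarrow> ('d \<Rightarrow> 'e::euclidean_space) \<Rightarrow> bool" where
  "Ck_on 0 S f \<longleftrightarrow> continuous_on S f"
| "Ck_on (Suc k) S f \<longleftrightarrow>
     (\<forall>x\<in>S. f differentiable (at x)) \<and>
     (\<forall>v. Ck_on k S (\<lambda>x. frechet_derivative f (at x) v))"

definition smooth_on :: "'d::euclidean_space set \<Rightarrow> ('d \<Rightarrow> 'e::euclidean_space) \<Rightarrow> bool" where
  "smooth_on S f \<longleftrightarrow> (\<forall>k. Ck_on k S f)"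


section \<open>Atlases and smooth maps\<close>

text \<open>A chart is a pair of its domain and a coordinate map, whose values outside the domain
  are irrelevant.\<close>

type_synonym ('a, 'e) chart = "'a set \<times> ('a \<Rightarrow> 'e)"
type_synonym ('a, 'e) atlas = "('a, 'e) chart set"

definition carrier_of :: "('a, 'e) atlas \<Rightarrow> 'a set" where
  "carrier_of A = (\<Union>c\<in>A. fst c)"

definition chart_inv :: "('a, 'e) chart \<Rightarrow> 'e \<Rightarrow> 'a" where
  "chart_inv c = inv_into (fst c) (snd c)"

text \<open>The manifold is the whole type \<open>'a\<close>; the Hausdorff and second countability axioms are
  carried by the sort. The atlas need not be maximal: it represents the smooth structure it
  generates. Charts map onto open subsets of the model space, so there is no boundary.\<close>

definition smooth_manifold ::
    "('a::{t2_space, second_countable_topology}, 'e::euclidean_space) atlas \<Rightarrow> bool" where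
  "smooth_manifold A \<longleftrightarrow>
     carrier_of A = UNIV \<and>
     (\<forall>c\<in>A. open (fst c) \<and> open (snd c ` fst c) \<and>
        homeomorphism (fst c) (snd c ` fst c) (snd c) (chart_inv c)) \<and>
     (\<forall>c\<in>A. \<forall>d\<in>A. smooth_on (snd c ` (fst c \<inter> fst d)) (snd d \<circ> chart_inv c))"

definition closed_smooth_manifold ::
    "('a::{t2_space, second_countable_topology}, 'e::euclidean_space) atlas \<Rightarrow> bool" where
  "closed_smooth_manifold A \<longleftrightarrow> smooth_manifold A \<and> compact (UNIV :: 'a set)"

text \<open>The openness clause says that \<open>F\<close> is continuous for the topologies generated by the
  charts. Thus no separate topology is needed on the total space of the tangent bundle, and
  the definition does not depend on the choice of atlases within a smooth structure.\<close>

definition smooth_map ::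
    "('a, 'd::euclidean_space) atlas \<Rightarrow> ('b, 'e::euclidean_space) atlas \<Rightarrow> ('a \<Rightarrow> 'b) \<Rightarrow> bool" where
  "smooth_map A B F \<longleftrightarrow>
     F ` carrier_of A \<subseteq> carrier_of B \<and>
     (\<forall>c\<in>A. \<forall>d\<in>B.
        open (snd c ` (fst c \<inter> F -` fst d)) \<and>
        smooth_on (snd c ` (fst c \<inter> F -` fst d)) (snd d \<circ> F \<circ> chart_inv c))"

definition self_diffeomorphism ::
    "('a, 'e::euclidean_space) atlas \<Rightarrow> ('a \<Rightarrow> 'a) \<Rightarrow> bool" where
  "self_diffeomorphism A f \<longleftrightarrow> bij f \<and> smooth_map A A f \<and> smooth_map A A (inv f)"

text \<open>The product manifold of \<open>M\<close> with the real line.\<close>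

definition times_real :: "('a, 'e) atlas \<Rightarrow> ('a \<times> real, 'e \<times> real) atlas" where
  "times_real A = (\<lambda>(U, \<phi>). (U \<times> UNIV, \<lambda>(p, t). (\<phi> p, t))) ` A"

text \<open>An isotopy is a smooth map on \<open>M \<times> [0,1]\<close> through diffeomorphisms; smoothness on the
  manifold with boundary \<open>M \<times> [0,1]\<close> is expressed by a smooth extension to \<open>M \<times> \<real>\<close>, on
  which nothing is required for parameters outside \<open>[0,1]\<close>.\<close>

definition isotopic ::
    "('a, 'e::euclidean_space) atlas \<Rightarrow> ('a \<Rightarrow> 'a) \<Rightarrow> ('a \<Rightarrow> 'a) \<Rightarrow> bool" where
  "isotopic A f h \<longleftrightarrow>
     (\<exists>H. smooth_map (times_real A) A H \<and>
        (\<forall>t\<in>{0..1}. self_diffeomorphism A (\<lambda>p. H (p, t))) \<and>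
        (\<forall>p. H (p, 0) = f p) \<and> (\<forall>p. H (p, 1) = h p))"


section \<open>Tangent bundle, vector fields and flows\<close>

text \<open>A tangent vector at \<open>p\<close> is given by its components in all charts around \<open>p\<close>, which
  transform by the derivative of the coordinate change. The value is fixed to 0 at the
  remaining arguments, so that distinct functions are distinct tangent vectors.\<close>

definition tangent_space ::
    "('a, 'e::euclidean_space) atlas \<Rightarrow> 'a \<Rightarrow> (('a, 'e) chart \<Rightarrow> 'e) set" where
  "tangent_space A p =
     {v. (\<forall>c. c \<notin> A \<or> p \<notin> fst c \<longrightarrow> v c = 0) \<and>
         (\<forall>c\<in>A. \<forall>d\<in>A. p \<in> fst c \<and> p \<in> fst d \<longrightarrow>
            v d = frechet_derivative (snd d \<circ> chart_inv c) (at (snd c p)) (v c))}"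

type_synonym ('a, 'e) tangent_vector = "'a \<times> (('a, 'e) chart \<Rightarrow> 'e)"

definition tangent_chart ::
    "('a, 'e::euclidean_space) atlas \<Rightarrow> ('a, 'e) chart \<Rightarrow> (('a, 'e) tangent_vector, 'e \<times> 'e) chart" where
  "tangent_chart A c =
     (SIGMA p : fst c. tangent_space A p, \<lambda>(p, v). (snd c p, v c))"

definition tangent_bundle ::
    "('a, 'e::euclidean_space) atlas \<Rightarrow> (('a, 'e) tangent_vector, 'e \<times> 'e) atlas" where
  "tangent_bundle A = tangent_chart A ` A"

definition smooth_vector_field ::
    "('a, 'e::euclidean_space) atlas \<Rightarrow> ('a \<Rightarrow> ('a, 'e) tangent_vector) \<Rightarrow> bool" where
  "smooth_vector_field A \<xi> \<longleftrightarrow> smooth_map A (tangent_bundle A) \<xi> \<and> fst \<circ> \<xi> = id"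

text \<open>Continuity is required separately, because a coordinate map takes arbitrary values
  outside its domain.\<close>

definition differentiable_curve_at ::
    "('a::topological_space, 'e::euclidean_space) atlas \<Rightarrow> (real \<Rightarrow> 'a) \<Rightarrow> real \<Rightarrow> bool" where
  "differentiable_curve_at A \<gamma> t \<longleftrightarrow>
     isCont \<gamma> t \<and> (\<forall>c\<in>A. \<gamma> t \<in> fst c \<longrightarrow> (snd c \<circ> \<gamma>) differentiable (at t))"

definition velocity ::
    "('a, 'e::euclidean_space) atlas \<Rightarrow> (real \<Rightarrow> 'a) \<Rightarrow> real \<Rightarrow> ('a, 'e) tangent_vector" where
  "velocity A \<gamma> t =
     (\<gamma> t, \<lambda>c. if c \<in> A \<and> \<gamma> t \<in> fst c then vector_derivative (snd c \<circ> \<gamma>) (at t) else 0)"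

definition integral_curve ::
    "('a::topological_space, 'e::euclidean_space) atlas \<Rightarrow> ('a \<Rightarrow> ('a, 'e) tangent_vector) \<Rightarrow>
     (real \<Rightarrow> 'a) \<Rightarrow> bool" where
  "integral_curve A \<xi> \<gamma> \<longleftrightarrow>
     (\<forall>t. differentiable_curve_at A \<gamma> t \<and> velocity A \<gamma> t = \<xi> (\<gamma> t))"

definition flow_of ::
    "('a::topological_space, 'e::euclidean_space) atlas \<Rightarrow> ('a \<Rightarrow> ('a, 'e) tangent_vector) \<Rightarrow>
     ('a \<times> real \<Rightarrow> 'a) \<Rightarrow> bool" where
  "flow_of A \<xi> \<Phi> \<longleftrightarrow> (\<forall>p. \<Phi> (p, 0) = p \<and> integral_curve A \<xi> (\<lambda>t. \<Phi> (p, t)))"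


section \<open>Root systems to the identity\<close>

definition zpow :: "('a \<Rightarrow> 'a) \<Rightarrow> int \<Rightarrow> 'a \<Rightarrow> 'a" where
  "zpow g a = (if a \<ge> 0 then g ^^ nat a else inv g ^^ nat (- a))"

text \<open>A sequence indexed by the positive integers is a function on \<open>nat\<close> whose value at 0 is
  irrelevant.\<close>

definition root_system ::
    "('a::topological_space, 'e::euclidean_space) atlas \<Rightarrow> ('a \<Rightarrow> 'a) \<Rightarrow> (nat \<Rightarrow> 'a \<Rightarrow> 'a) \<Rightarrow> bool" where
  "root_system A f g \<longleftrightarrow>
     (\<forall>b>0. self_diffeomorphism A (g b) \<and> isotopic A id (g b)) \<and>
     (\<forall>b>0. g b ^^ b = f) \<and>
     (\<forall>b1>0. \<forall>b2>0. \<forall>p.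
        g b1 (g b2 p) = (g (b1 * b2) ^^ (b1 + b2)) p \<and>
        (g (b1 * b2) ^^ (b1 + b2)) p = g b2 (g b1 p)) \<and>
     (\<forall>a::int. \<forall>b>0.
        zpow (g b) a = zpow (g (b div nat (gcd a (int b)))) (a div gcd a (int b))) \<and>
     (\<forall>p. (\<lambda>b. g b p) \<longlonglongrightarrow> p)"

definition continuous_extension ::
    "(nat \<Rightarrow> 'a::topological_space \<Rightarrow> 'a) \<Rightarrow> ('a \<times> real \<Rightarrow> 'a) \<Rightarrow> bool" where
  "continuous_extension g \<Psi> \<longleftrightarrow>
     continuous_on UNIV \<Psi> \<and>
     (\<forall>a::int. \<forall>b>0. \<forall>p. \<Psi> (p, real_of_int a / real b) = zpow (g b) a p)"

definition smooth_root_system ::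
    "('a::topological_space, 'e::euclidean_space) atlas \<Rightarrow> ('a \<Rightarrow> 'a) \<Rightarrow> (nat \<Rightarrow> 'a \<Rightarrow> 'a) \<Rightarrow> bool" where
  "smooth_root_system A f g \<longleftrightarrow>
     root_system A f g \<and>
     (\<exists>\<Psi>. continuous_extension g \<Psi> \<and> smooth_map (times_real A) A \<Psi>)"

definition smoothly_rootable ::
    "('a::topological_space, 'e::euclidean_space) atlas \<Rightarrow> ('a \<Rightarrow> 'a) \<Rightarrow> bool" where
  "smoothly_rootable A f \<longleftrightarrow> isotopic A id f \<and> (\<exists>g. smooth_root_system A f g)"

end

theory Submission
  imports Defs
begin

text \<open>
  A root system with a continuous extension \<open>\<Psi>\<close> makes \<open>\<Psi>\<close> an action of the real line: on rational
  times this is the functional equation of integer powers over a common denominator, and continuity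
  extends it. If \<open>\<Psi>\<close> is moreover smooth, it is the flow of its velocity field at time 0.

  Conversely, the maps \<open>\<Phi>\<^sub>1\<^sub>/\<^sub>b\<close> of a flow form a root system, and the point is that a flow is jointly
  smooth. Locally this is smooth dependence of \<open>y' = F(x, t, y)\<close> on the parameter \<open>x\<close>: the difference
  quotients in \<open>x\<close> satisfy the variational equation up to a small error, so by Gronwall's inequality
  they converge, and their limit \<open>z\<close> solves an equation of the same form with one derivative less; hence
  \<open>y\<close> is \<open>C\<^sup>k\<close> by induction on \<open>k\<close>. Compactness gives smoothness on \<open>M \<times> (-\<epsilon>, \<epsilon>)\<close> for a uniform \<open>\<epsilon>\<close>, and
  the group law does the rest.
\<close>

section \<open>Calculus of \<open>C\<^sup>k\<close> maps\<close>

text \<open>The induction on \<open>k\<close> closes only if the variational equation satisfies the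
  same hypotheses as the equation it comes from. Its state space is the whole vector space and its
  right hand side need not be bounded there, so a bound on \<open>F\<close> could not be carried
  along. What survives is a Lipschitz constant in the state, uniform in parameter and time: the
  derivative of \<open>F\<close> in the state directions inherits the same \<open>L\<close>. With
  this as the hypothesis, neither the parameter set \<open>W\<close> nor the time interval ever
  shrinks, and every estimate ends in Gronwall's inequality with constant \<open>L\<close>. The
  equation of a flow in a chart is autonomous and its parameter is the initial point; a right hand
  side that depends on the parameter appears after one differentiation, because the coefficients
  then contain \<open>y (x, t)\<close>. On the manifold, smoothness is treated at a single point in
  freely chosen charts, so that smoothness of the flow rests on a short-time statement in one
  chart.\<close>

lemma Ck_on_subset: "Ck_on k S f \<Longrightarrow> T \<subseteq> S \<Longrightarrow> Ck_on k T f"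
  by (induction k arbitrary: f) (auto intro: continuous_on_subset)

lemma Ck_on_Suc_frechet_derivative:
  "Ck_on (Suc k) S f \<Longrightarrow> Ck_on k S (\<lambda>x. frechet_derivative f (at x) v)"
  by simp

text \<open>On an open set, agreement of the functions forces agreement of their derivatives, which
  is what the induction hypothesis needs.\<close>

lemma Ck_on_cong:
  assumes "open S" "\<And>x. x \<in> S \<Longrightarrow> f x = g x" "Ck_on k S f"
  shows "Ck_on k S g"
  using assms(3,2)
proof (induction k arbitrary: f g)
  case 0
  then show ?case
    by (metis Ck_on.simps(1) continuous_on_cong)
next
  case (Suc k)
  have d: "(g has_derivative frechet_derivative f (at x)) (at x)" if "x \<in> S" for x
    using has_derivative_transform_within_open[OF _ assms(1) that Suc.prems(2)] Suc.prems(1) that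
    by (auto simp: frechet_derivative_works[symmetric])
  have "Ck_on k S (\<lambda>x. frechet_derivative g (at x) v)" for v
    by (rule Suc.IH[OF Ck_on_Suc_frechet_derivative[OF Suc.prems(1)] fun_cong[OF frechet_derivative_at[OF d]]])
  with d show ?case
    by (auto simp: differentiable_def)
qed

text \<open>\<open>frechet_derivative\<close> is a choice operator; here it is traded for any
  explicit derivative \<open>f'\<close>. The inductive closure proofs below have this shape: take
  \<open>f'\<close> from a differentiation rule, then show that its directional values are of class
  \<open>C^k\<close>.\<close>

lemma Ck_on_SucI:
  assumes "open S" "\<And>x. x \<in> S \<Longrightarrow> (f has_derivative f' x) (at x)"
    "\<And>v. Ck_on k S (\<lambda>x. f' x v)"
  shows "Ck_on (Suc k) S f"
proof -
  have "Ck_on k S (\<lambda>x. frechet_derivative f (at x) v)" for v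
    by (rule Ck_on_cong[OF assms(1) _ assms(3)[of v]]) (simp add: assms(2)[THEN frechet_derivative_at, symmetric])
  with assms(2) show ?thesis
    by (auto simp: differentiable_def)
qed

lemma Ck_on_Suc_has_derivative:
  "Ck_on (Suc k) S f \<Longrightarrow> x \<in> S \<Longrightarrow> (f has_derivative frechet_derivative f (at x)) (at x)"
  by (auto simp: frechet_derivative_works[symmetric])

lemma Ck_on_SucD: "Ck_on (Suc k) S f \<Longrightarrow> Ck_on k S f"
proof (induction k arbitrary: f)
  case 0
  then show ?case
    by (auto intro!: differentiable_imp_continuous_on simp: differentiable_on_def differentiable_at_withinI)
qed auto

lemma Ck_on_le: "Ck_on k S f \<Longrightarrow> m \<le> k \<Longrightarrow> Ck_on m S f"
  by (induction k) (auto simp: le_Suc_eq dest: Ck_on_SucD simp del: Ck_on.simps)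

lemma Ck_on_imp_continuous_on: "Ck_on k S f \<Longrightarrow> continuous_on S f"
  using Ck_on_le[of k S f 0] by simp

lemma Ck_on_const: "open S \<Longrightarrow> Ck_on k S (\<lambda>x. c)"
proof (induction k arbitrary: c)
  case (Suc k)
  then show ?case
    by (intro Ck_on_SucI[of S _ "\<lambda>_ _. 0"]) auto
qed auto

lemma Ck_on_bounded_linear_compose:
  assumes "bounded_linear L" "open S"
  shows "Ck_on k S f \<Longrightarrow> Ck_on k S (\<lambda>x. L (f x))"
proof (induction k arbitrary: f)
  case 0
  then show ?case
    using assms(1) by (auto intro: bounded_linear.continuous_on)
next
  case (Suc k)
  show ?case
    by (rule Ck_on_SucI[OF assms(2)])
      (rule bounded_linear.has_derivative[OF assms(1) Ck_on_Suc_has_derivative[OF Suc.prems]], assumption,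
        rule Suc.IH[OF Ck_on_Suc_frechet_derivative[OF Suc.prems]])
qed

lemma Ck_on_ident:
  assumes "open S"
  shows "Ck_on k S (\<lambda>x. x)"
proof (cases k)
  case (Suc m)
  then show ?thesis
    using Ck_on_SucI[OF assms, of "\<lambda>x. x" "\<lambda>_ h. h" m] Ck_on_const[OF assms]
    by (metis has_derivative_ident)
qed auto

lemma Ck_on_bounded_linear: "bounded_linear L \<Longrightarrow> open S \<Longrightarrow> Ck_on k S L"
  using Ck_on_bounded_linear_compose[OF _ _ Ck_on_ident, of L S k] by simp

lemma Ck_on_add:
  assumes "open S"
  shows "Ck_on k S f \<Longrightarrow> Ck_on k S g \<Longrightarrow> Ck_on k S (\<lambda>x. f x + g x)"
proof (induction k arbitrary: f g)
  case 0
  then show ?case by (auto intro: continuous_on_add)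
next
  case (Suc k)
  show ?case
    by (rule Ck_on_SucI[OF assms])
      (rule has_derivative_add[OF Suc.prems[THEN Ck_on_Suc_has_derivative]], assumption+,
        rule Suc.IH[OF Suc.prems[THEN Ck_on_Suc_frechet_derivative]])
qed

lemma Ck_on_sum:
  assumes "open S" "\<And>i. i \<in> I \<Longrightarrow> Ck_on k S (f i)"
  shows "Ck_on k S (\<lambda>x. \<Sum>i\<in>I. f i x)"
  using assms(2)
  by (induction I rule: infinite_finite_induct) (simp_all add: Ck_on_const Ck_on_add assms(1) del: Ck_on.simps)

lemma Ck_on_bilinear:
  assumes "bounded_bilinear B" "open S"
  shows "Ck_on k S f \<Longrightarrow> Ck_on k S g \<Longrightarrow> Ck_on k S (\<lambda>x. B (f x) (g x))"
proof (induction k arbitrary: f g)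
  case 0
  then show ?case by (auto intro: bounded_bilinear.continuous_on[OF assms(1)])
next
  case (Suc k)
  \<comment> \<open>Each term of the product rule keeps one factor undifferentiated, so that factor
    is needed at the lower order \<open>k\<close> as well.\<close>
  show ?case
    by (rule Ck_on_SucI[OF assms(2)])
      (rule bounded_bilinear.FDERIV[OF assms(1) Suc.prems[THEN Ck_on_Suc_has_derivative]], assumption+,
        intro Ck_on_add assms(2) Suc.IH Suc.prems Suc.prems[THEN Ck_on_SucD]
          Suc.prems[THEN Ck_on_Suc_frechet_derivative])
qed

lemma Ck_on_Pair:
  assumes "open S" "Ck_on k S f" "Ck_on k S g"
  shows "Ck_on k S (\<lambda>x. (f x, g x))"
proof -
  have "bounded_linear (\<lambda>a::'b. (a, 0::'c))" "bounded_linear (\<lambda>b::'c. (0::'b, b))"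
    by (auto intro!: bounded_linear_Pair bounded_linear_ident bounded_linear_zero)
  from Ck_on_add[OF assms(1) Ck_on_bounded_linear_compose[OF this(1) assms(1,2)]
      Ck_on_bounded_linear_compose[OF this(2) assms(1,3)]]
  show ?thesis by simp
qed

lemma linear_eq_sum_Basis:
  fixes L :: "'a::euclidean_space \<Rightarrow> 'b::real_vector"
  assumes "linear L"
  shows "L v = (\<Sum>i\<in>Basis. (v \<bullet> i) *\<^sub>R L i)"
proof -
  have "L v = L (\<Sum>i\<in>Basis. (v \<bullet> i) *\<^sub>R i)"
    by (simp add: euclidean_representation)
  then show ?thesis
    by (simp add: linear_sum[OF assms] linear_cmul[OF assms])
qed

text \<open>The maps \<open>A x\<close> are known to be \<open>C^k\<close> only on fixed vectors.
  Expanding the moving vector \<open>f x\<close> in the basis reduces its image to finitely many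
  products of a scalar and a vector function.\<close>

lemma Ck_on_linear_apply:
  fixes A :: "'a::euclidean_space \<Rightarrow> 'b::euclidean_space \<Rightarrow> 'c::euclidean_space"
  assumes "open S" "\<And>x. x \<in> S \<Longrightarrow> linear (A x)" "\<And>v. Ck_on k S (\<lambda>x. A x v)" "Ck_on k S f"
  shows "Ck_on k S (\<lambda>x. A x (f x))"
proof (rule Ck_on_cong[OF assms(1)])
  show "Ck_on k S (\<lambda>x. \<Sum>i\<in>Basis. (f x \<bullet> i) *\<^sub>R A x i)"
    by (intro Ck_on_sum Ck_on_bilinear[OF bounded_bilinear_scaleR] assms
        Ck_on_bounded_linear_compose[OF bounded_linear_inner_left])
  show "(\<Sum>i\<in>Basis. (f x \<bullet> i) *\<^sub>R A x i) = A x (f x)" if "x \<in> S" for x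
    using linear_eq_sum_Basis[OF assms(2)[OF that]] by metis
qed

text \<open>The derivative of the composition is a linear map depending on \<open>x\<close>,
  evaluated at a vector depending on \<open>x\<close>. The induction hypothesis handles the
  derivative of \<open>g\<close> along \<open>f\<close> for a fixed vector, and
  \<open>Ck_on_linear_apply\<close> then admits the moving one.\<close>

lemma Ck_on_compose:
  fixes f :: "'a::euclidean_space \<Rightarrow> 'b::euclidean_space" and g :: "'b \<Rightarrow> 'c::euclidean_space"
  assumes "open S" "open T"
  shows "Ck_on k T g \<Longrightarrow> Ck_on k S f \<Longrightarrow> f ` S \<subseteq> T \<Longrightarrow> Ck_on k S (\<lambda>x. g (f x))"
proof (induction k arbitrary: f g)
  case 0
  then show ?case by (auto intro: continuous_on_compose2)
next
  case (Suc k)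
  let ?g' = "\<lambda>x. frechet_derivative g (at (f x))" and ?f' = "\<lambda>x. frechet_derivative f (at x)"
  have g: "(g has_derivative ?g' x) (at (f x))" if "x \<in> S" for x
    using Suc.prems that by (intro Ck_on_Suc_has_derivative[of k T]) auto
  have f: "(f has_derivative ?f' x) (at x)" if "x \<in> S" for x
    using Suc.prems that by (intro Ck_on_Suc_has_derivative[of k S]) auto
  have gv: "Ck_on k S (\<lambda>x. ?g' x v)" for v
    by (rule Suc.IH[OF Ck_on_Suc_frechet_derivative[OF Suc.prems(1)] Ck_on_SucD[OF Suc.prems(2)] Suc.prems(3)])
  have d: "Ck_on k S (\<lambda>x. ?g' x (?f' x v))" for v
    by (rule Ck_on_linear_apply[OF assms(1) has_derivative_linear[OF g] gv
          Ck_on_Suc_frechet_derivative[OF Suc.prems(2)]])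
  show ?case
    by (rule Ck_on_SucI[OF assms(1) has_derivative_compose[OF f g] d])
qed

lemma Ck_on_UnionI: "(\<And>S. S \<in> \<S> \<Longrightarrow> open S \<and> Ck_on k S f) \<Longrightarrow> Ck_on k (\<Union>\<S>) f"
proof (induction k arbitrary: f)
  case 0
  then show ?case by (auto intro!: continuous_on_open_Union)
qed auto

lemma smooth_on_subset: "smooth_on S f \<Longrightarrow> T \<subseteq> S \<Longrightarrow> smooth_on T f"
  by (auto simp: smooth_on_def intro: Ck_on_subset)

lemma smooth_on_cong:
  "open S \<Longrightarrow> smooth_on S f \<Longrightarrow> (\<And>x. x \<in> S \<Longrightarrow> f x = g x) \<Longrightarrow> smooth_on S g"
  by (auto simp: smooth_on_def intro: Ck_on_cong)

lemma smooth_on_compose: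
  "open S \<Longrightarrow> open T \<Longrightarrow> smooth_on T g \<Longrightarrow> smooth_on S f \<Longrightarrow> f ` S \<subseteq> T \<Longrightarrow> smooth_on S (\<lambda>x. g (f x))"
  by (auto simp: smooth_on_def intro: Ck_on_compose)

lemma smooth_on_Pair:
  "open S \<Longrightarrow> smooth_on S f \<Longrightarrow> smooth_on S g \<Longrightarrow> smooth_on S (\<lambda>x. (f x, g x))"
  by (auto simp: smooth_on_def intro: Ck_on_Pair)

lemma smooth_on_bounded_linear: "open S \<Longrightarrow> bounded_linear L \<Longrightarrow> smooth_on S L"
  by (auto simp: smooth_on_def intro: Ck_on_bounded_linear)

lemma smooth_on_const: "open S \<Longrightarrow> smooth_on S (\<lambda>x. c)"
  by (auto simp: smooth_on_def intro: Ck_on_const)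

lemma smooth_on_ident: "open S \<Longrightarrow> smooth_on S (\<lambda>x. x)"
  by (auto simp: smooth_on_def intro: Ck_on_ident)

lemma smooth_on_UnionI: "(\<And>S. S \<in> \<S> \<Longrightarrow> open S \<and> smooth_on S f) \<Longrightarrow> smooth_on (\<Union>\<S>) f"
  by (auto simp: smooth_on_def intro: Ck_on_UnionI)

lemma smooth_on_imp_continuous_on: "smooth_on S f \<Longrightarrow> continuous_on S f"
  by (metis Ck_on.simps(1) smooth_on_def)

lemma smooth_on_has_derivative:
  "smooth_on S f \<Longrightarrow> x \<in> S \<Longrightarrow> (f has_derivative frechet_derivative f (at x)) (at x)"
  by (metis Ck_on_Suc_has_derivative smooth_on_def)

lemma smooth_on_frechet_derivative:
  assumes "smooth_on S f"
  shows "smooth_on S (\<lambda>x. frechet_derivative f (at x) v)"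
proof -
  have "Ck_on (Suc k) S f" for k
    using assms by (simp only: smooth_on_def)
  then show ?thesis
    by (auto simp: smooth_on_def)
qed

section \<open>Differential equations with parameters\<close>

text \<open>First order Taylor expansion with an error uniform over a compact set. On a slightly
  larger compact set the derivative is uniformly continuous, and the mean value inequality turns its
  small variation into a small remainder.\<close>

lemma Ck_1_uniformly_differentiable_on_compact:
  fixes f :: "'a::euclidean_space \<Rightarrow> 'b::euclidean_space"
  assumes "open S" "Ck_on (Suc 0) S f" "compact K" "K \<subseteq> S" "\<eta> > 0"
  obtains \<delta> where "\<delta> > 0"
    "\<And>p q. p \<in> K \<Longrightarrow> norm (q - p) < \<delta> \<Longrightarrow> q \<in> S \<and>
      norm (f q - f p - frechet_derivative f (at p) (q - p)) \<le> \<eta> * norm (q - p)"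
proof -
  let ?D = "\<lambda>x. frechet_derivative f (at x)"
  obtain e where e: "e > 0" "(\<Union>x\<in>K. cball x e) \<subseteq> S"
    using compact_subset_open_imp_cball_epsilon_subset[OF assms(3,1,4)] by blast
  define K' where "K' = (\<Union>x\<in>K. cball x e)"
  have K': "compact K'" "K' \<subseteq> S" "K \<subseteq> K'"
    using e compact_minkowski_sum_cball[OF assms(3), of e] by (auto simp: K'_def)
  have der: "(f has_derivative ?D x) (at x)" if "x \<in> S" for x
    using Ck_on_Suc_has_derivative assms(2) that by blast
  \<comment> \<open>\<open>Ck_on\<close> controls the derivative only direction by direction; the
    sum over the basis dominates the operator norm of \<open>?D q - ?D p\<close>.\<close>
  define \<phi> where "\<phi> = (\<lambda>(p, q). \<Sum>i\<in>Basis. norm (?D q i - ?D p i))"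
  have D: "continuous_on K' (\<lambda>x. ?D x v)" for v
    using assms(2) K'(2) by (auto intro: continuous_on_subset)
  have "continuous_on (K' \<times> K') (\<lambda>x. \<Sum>i\<in>Basis. norm (?D (snd x) i - ?D (fst x) i))"
    by (intro continuous_intros continuous_on_compose2[OF D]) auto
  then have "uniformly_continuous_on (K' \<times> K') \<phi>"
    using K'(1) by (intro compact_uniformly_continuous compact_Times) (simp_all add: \<phi>_def case_prod_beta)
  then obtain d where d: "d > 0"
    "\<And>x y. x \<in> K' \<times> K' \<Longrightarrow> y \<in> K' \<times> K' \<Longrightarrow> dist y x < d \<Longrightarrow> dist (\<phi> y) (\<phi> x) < \<eta>"
    using assms(5) unfolding uniformly_continuous_on_def by metis
  show thesis
  proof (rule that[of "min d e"])
    show "min d e > 0" using d e by simp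
    fix p q assume p: "p \<in> K" and q: "norm (q - p) < min d e"
    have sub: "ball p (min d e) \<subseteq> K'"
      using p by (auto simp: K'_def)
    have pb: "p \<in> ball p (min d e)" and qb: "q \<in> ball p (min d e)"
      using q d e by (auto simp: dist_norm norm_minus_commute)
    \<comment> \<open>The mean value inequality is applied to \<open>f\<close> minus its
      linearization at \<open>p\<close>, whose derivative at \<open>x\<close> is
      \<open>?D x - ?D p\<close>.\<close>
    have "norm ((f q - ?D p q) - (f p - ?D p p)) \<le> \<eta> * norm (q - p)"
    proof (rule differentiable_bound[OF convex_ball _ _ qb pb])
      fix x assume x: "x \<in> ball p (min d e)"
      have lp: "linear (?D p)" and lx: "linear (?D x)"
        using der p x sub K' has_derivative_linear by blast+
      show "((\<lambda>x. f x - ?D p x) has_derivative (\<lambda>h. ?D x h - ?D p h)) (at x within ball p (min d e))"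
        using x sub K'(2) lp
        by (intro has_derivative_diff has_derivative_at_withinI[OF der] bounded_linear_imp_has_derivative)
          (auto simp: linear_conv_bounded_linear)
      have "dist (p, x) (p, p) < d"
        using x by (simp add: dist_Pair_Pair dist_commute)
      then have "dist (\<phi> (p, x)) (\<phi> (p, p)) < \<eta>"
        using x p sub K' by (intro d) auto
      then have \<phi>: "\<phi> (p, x) < \<eta>"
        by (simp add: \<phi>_def)
      show "onorm (\<lambda>h. ?D x h - ?D p h) \<le> \<eta>"
      proof (rule onorm_le)
        fix h
        have "?D x h - ?D p h = (\<Sum>i\<in>Basis. (h \<bullet> i) *\<^sub>R (?D x i - ?D p i))"
          using linear_eq_sum_Basis[OF lx, of h] linear_eq_sum_Basis[OF lp, of h]
          by (simp add: scaleR_diff_right sum_subtractf)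
        also have "norm \<dots> \<le> (\<Sum>i\<in>Basis. norm h * norm (?D x i - ?D p i))"
          by (intro sum_norm_le) (simp add: Basis_le_norm mult_right_mono)
        also have "\<dots> = \<phi> (p, x) * norm h"
          by (simp add: \<phi>_def sum_distrib_left mult.commute)
        finally show "norm (?D x h - ?D p h) \<le> \<eta> * norm h"
          using \<phi> by (smt (verit) mult_right_mono norm_ge_zero)
      qed
    qed
    moreover have "?D p q - ?D p p = ?D p (q - p)"
      using der p K' by (intro linear_diff[symmetric] has_derivative_linear) blast
    ultimately show "q \<in> S \<and> norm (f q - f p - ?D p (q - p)) \<le> \<eta> * norm (q - p)"
      using qb sub K' by (auto simp: algebra_simps)
  qed
qed

text \<open>Dividing the Lipschitz bound at \<open>x + s v\<close> by \<open>s\<close> leaves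
  \<open>norm (f' v)\<close> up to an arbitrarily small error.\<close>

lemma has_derivative_norm_le_Lipschitz:
  fixes f :: "'a::real_normed_vector \<Rightarrow> 'b::real_normed_vector"
  assumes f: "(f has_derivative f') (at x)" and "open S" "x \<in> S"
    and "\<And>y. y \<in> S \<Longrightarrow> norm (f y - f x) \<le> L * norm (y - x)"
  shows "norm (f' v) \<le> L * norm v"
proof -
  have f'_lin: "linear f'"
    using f by (rule has_derivative_linear)
  show ?thesis
  proof (rule field_le_epsilon)
    fix e :: real assume "e > 0"
    \<comment> \<open>The summand 1 keeps the later divisions meaningful when
      \<open>v = 0\<close>.\<close>
    define n where "n = norm v + 1"
    have n: "n > 0" "norm v < n" by (simp_all add: n_def add_nonneg_pos)
    obtain d where d: "d > 0" "\<And>y. norm (y - x) < d \<Longrightarrow> norm (f y - f x - f' (y - x)) \<le> e / n * norm (y - x)"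
      using f \<open>e > 0\<close> n unfolding has_derivative_at_alt by (metis zero_less_divide_iff)
    obtain r where r: "r > 0" "ball x r \<subseteq> S"
      using assms(2,3) openE by blast
    define s where "s = min d r / n"
    define y where "y = x + s *\<^sub>R v"
    have s: "s > 0" using d r n by (simp add: s_def)
    have "s * norm v < s * n"
      using s n by simp
    then have sv: "s * norm v < d" "s * norm v < r"
      using n by (simp_all add: s_def)
    have y: "norm (y - x) = s * norm v" "f' (y - x) = s *\<^sub>R f' v"
      using s linear_cmul[OF f'_lin] by (simp_all add: y_def)
    have "y \<in> S"
      using sv r s by (auto simp: y_def dist_norm)
    then have "s * norm (f' v) \<le> L * (s * norm v) + e / n * (s * norm v)"
      using d(2)[of y] assms(4)[of y] sv y s
      by (smt (verit) norm_scaleR norm_triangle_ineq2 norm_minus_commute)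
    then have "s * norm (f' v) \<le> s * (L * norm v + e / n * norm v)"
      by (simp add: algebra_simps)
    then have "norm (f' v) \<le> L * norm v + e / n * norm v"
      using s by (simp only: mult_le_cancel_left_pos)
    also have "e / n * norm v \<le> e"
      using n \<open>e > 0\<close> by (simp add: field_simps)
    finally show "norm (f' v) \<le> L * norm v + e" by simp
  qed
qed

text \<open>Energy method: the norm may fail to be differentiable where \<open>u\<close> vanishes,
  but its square is differentiable, and the sum of the squares of \<open>norm u\<close> and
  \<open>\<delta>\<close>, damped by an exponential, does not increase. Putting
  \<open>\<delta>\<close> into the energy absorbs the inhomogeneous term.\<close>

lemma norm_le_gronwall_right:
  fixes u :: "real \<Rightarrow> 'a::real_inner"
  assumes "a \<le> b" "0 \<le> K" "0 \<le> \<delta>"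
    and u: "\<And>t. a \<le> t \<Longrightarrow> t \<le> b \<Longrightarrow> (u has_vector_derivative u' t) (at t)"
    and u': "\<And>t. a \<le> t \<Longrightarrow> t \<le> b \<Longrightarrow> norm (u' t) \<le> K * norm (u t) + \<delta>"
  shows "norm (u b) \<le> (norm (u a) + \<delta>) * exp ((K + 1) * (b - a))"
proof -
  \<comment> \<open>From \<open>2 * norm u * (K * norm u + \<delta>) \<le> (2 * K + 1) * (norm u)^2
    + \<delta>^2\<close>, where the cross term is split into two squares. Half of \<open>C\<close>
    is \<open>K + 1/2\<close>, rounded up to \<open>K + 1\<close> in the final exponent.\<close>
  define C where "C = 2 * K + 1"
  have C: "C \<ge> 1" using assms by (simp add: C_def)
  define g where "g t = ((norm (u t))\<^sup>2 + \<delta>\<^sup>2) * exp (- C * (t - a))" for t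
  have "g b \<le> g a"
  proof (rule DERIV_nonpos_imp_nonincreasing[OF assms(1)])
    fix t assume t: "a \<le> t" "t \<le> b"
    have ip: "((\<lambda>t. u t \<bullet> u t) has_real_derivative 2 * (u t \<bullet> u' t)) (at t)"
      using u[OF t] unfolding has_field_derivative_def has_vector_derivative_def
      by (auto intro!: derivative_eq_intros simp: inner_commute algebra_simps)
    have g: "(g has_real_derivative
        (2 * (u t \<bullet> u' t) - C * ((norm (u t))\<^sup>2 + \<delta>\<^sup>2)) * exp (- C * (t - a))) (at t)"
      unfolding g_def[abs_def] power2_norm_eq_inner
      by (auto intro!: derivative_eq_intros ip simp: algebra_simps)
    have "u t \<bullet> u' t \<le> norm (u t) * norm (u' t)"
      by (rule norm_cauchy_schwarz)
    also have "\<dots> \<le> norm (u t) * (K * norm (u t) + \<delta>)"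
      by (intro mult_left_mono u' t) auto
    also have "2 * \<dots> = 2 * K * (norm (u t))\<^sup>2 + 2 * norm (u t) * \<delta>"
      by (simp add: algebra_simps power2_eq_square)
    also have "2 * norm (u t) * \<delta> \<le> (norm (u t))\<^sup>2 + \<delta>\<^sup>2"
      by (rule sum_squares_bound)
    also have "\<delta>\<^sup>2 \<le> C * \<delta>\<^sup>2"
      using C by (simp add: mult_le_cancel_right1)
    finally have "2 * (u t \<bullet> u' t) - C * ((norm (u t))\<^sup>2 + \<delta>\<^sup>2) \<le> 0"
      by (simp add: C_def algebra_simps)
    with g show "\<exists>y. (g has_real_derivative y) (at t) \<and> y \<le> 0"
      by (meson exp_ge_zero mult_nonpos_nonneg)
  qed
  then have "(norm (u b))\<^sup>2 + \<delta>\<^sup>2 \<le> ((norm (u a))\<^sup>2 + \<delta>\<^sup>2) * exp (C * (b - a))"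
    by (simp add: g_def exp_minus divide_inverse[symmetric] pos_divide_le_eq)
  also have "\<dots> \<le> (norm (u a) + \<delta>)\<^sup>2 * exp ((K + 1) * (b - a)) ^ 2"
    using assms(1-3)
    by (intro mult_mono) (auto simp: power2_sum C_def exp_double[symmetric] algebra_simps mult_left_mono)
  finally have "(norm (u b))\<^sup>2 \<le> ((norm (u a) + \<delta>) * exp ((K + 1) * (b - a)))\<^sup>2"
    by (smt (verit) power_mult_distrib zero_le_power2)
  then show ?thesis
    by (rule power2_le_imp_le) (simp add: assms(3))
qed

text \<open>Solutions are compared backwards in time too. Time reversal reduces that case to the
  forward one, and \<open>closed_segment\<close> covers both orders of the endpoints.\<close>

lemma norm_le_gronwall:
  fixes u :: "real \<Rightarrow> 'a::real_inner"
  assumes "0 \<le> K" "0 \<le> \<delta>"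
    and u: "\<And>t. t \<in> closed_segment a b \<Longrightarrow> (u has_vector_derivative u' t) (at t)"
    and u': "\<And>t. t \<in> closed_segment a b \<Longrightarrow> norm (u' t) \<le> K * norm (u t) + \<delta>"
  shows "norm (u b) \<le> (norm (u a) + \<delta>) * exp ((K + 1) * \<bar>b - a\<bar>)"
proof (cases "a \<le> b")
  case True
  then show ?thesis
    using norm_le_gronwall_right[of a b K \<delta> u u'] assms by (simp add: closed_segment_eq_real_ivl)
next
  case False
  have "((\<lambda>t. u (- t)) has_vector_derivative - u' (- t)) (at t)" if "- a \<le> t" "t \<le> - b" for t
  proof -
    have "(u has_vector_derivative u' (- t)) (at (- t))"
      using that False by (intro u) (auto simp: closed_segment_eq_real_ivl)
    moreover have "(uminus has_vector_derivative (- 1 :: real)) (at t)"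
      by (auto intro!: derivative_eq_intros)
    ultimately show ?thesis
      using vector_diff_chain_at[of uminus "-1" t u "u' (- t)"] by (simp add: o_def)
  qed
  then show ?thesis
    using norm_le_gronwall_right[of "-a" "-b" K \<delta> "\<lambda>t. u (- t)" "\<lambda>t. - u' (- t)"] assms False
    by (simp add: closed_segment_eq_real_ivl)
qed

lemma has_derivative_imp_local_Lipschitz:
  assumes "(f has_derivative f') (at x)"
  obtains C \<delta> where "C \<ge> 0" "\<delta> > 0" "\<And>z. norm (z - x) < \<delta> \<Longrightarrow> norm (f z - f x) \<le> C * norm (z - x)"
proof -
  obtain \<delta> where \<delta>: "\<delta> > 0" "\<And>z. norm (z - x) < \<delta> \<Longrightarrow> norm (f z - f x - f' (z - x)) \<le> 1 * norm (z - x)"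
    using assms zero_less_one unfolding has_derivative_at_alt by meson
  obtain K where K: "K > 0" "\<And>h. norm (f' h) \<le> norm h * K"
    using bounded_linear.pos_bounded[OF has_derivative_bounded_linear[OF assms]] by blast
  show thesis
  proof (rule that[of "K + 1" \<delta>])
    fix z assume "norm (z - x) < \<delta>"
    then show "norm (f z - f x) \<le> (K + 1) * norm (z - x)"
      using \<delta>(2)[of z] K(2)[of "z - x"] norm_triangle_ineq2[of "f z - f x" "f' (z - x)"]
      by (simp add: algebra_simps)
  qed (use K \<delta> in auto)
qed

text \<open>A family of differential equations together with a family of solutions on a common time
  interval: \<open>x\<close> is the parameter. Regularity of \<open>F\<close> is left to the
  individual lemmas, since its order drops from one induction step to the next.\<close>

locale parametric_ode =
  fixes W :: "'p::euclidean_space set" and e :: real and V :: "'y::euclidean_space set"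
    and F :: "'p \<times> real \<times> 'y \<Rightarrow> 'y" and L :: real and y :: "'p \<times> real \<Rightarrow> 'y"
  assumes open_W: "open W" and open_V: "open V" and L_nonneg: "0 \<le> L"
    and lipschitz: "\<And>x t u w. x \<in> W \<Longrightarrow> t \<in> {-e<..<e} \<Longrightarrow> u \<in> V \<Longrightarrow> w \<in> V \<Longrightarrow>
      norm (F (x, t, u) - F (x, t, w)) \<le> L * norm (u - w)"
    and solution_in: "\<And>x t. x \<in> W \<Longrightarrow> t \<in> {-e<..<e} \<Longrightarrow> y (x, t) \<in> V"
    and solution_derivative: "\<And>x t. x \<in> W \<Longrightarrow> t \<in> {-e<..<e} \<Longrightarrow>
      ((\<lambda>t. y (x, t)) has_vector_derivative F (x, t, y (x, t))) (at t)"
begin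

abbreviation I where "I \<equiv> {-e<..<e}"

abbreviation D where "D x t \<equiv> frechet_derivative F (at (x, t, y (x, t)))"

lemma open_domain: "open (W \<times> I \<times> V)"
  by (intro open_Times open_W open_V) auto

section \<open>Continuous dependence on the parameter\<close>

lemma continuous_on_solution:
  assumes "x \<in> W"
  shows "continuous_on I (\<lambda>t. y (x, t))"
  by (intro continuous_at_imp_continuous_on ballI has_vector_derivative_continuous[OF solution_derivative[OF assms]])

lemma segment_in_I: "T < e \<Longrightarrow> t \<in> {-T..T} \<Longrightarrow> s \<in> closed_segment 0 t \<Longrightarrow> s \<in> I \<and> s \<in> {-T..T}"
  by (auto simp: closed_segment_eq_real_ivl split: if_splits)

lemma solution_difference_derivative:
  assumes "x \<in> W" "x0 \<in> W" "t \<in> I"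
  shows "((\<lambda>t. y (x, t) - y (x0, t)) has_vector_derivative F (x, t, y (x, t)) - F (x0, t, y (x0, t))) (at t)"
  by (intro has_vector_derivative_diff solution_derivative assms)

text \<open>The difference of the two right hand sides is split into a change of state at the fixed
  parameter \<open>x\<close>, controlled by \<open>L\<close>, and a change of parameter along the
  trajectory of \<open>x0\<close>, controlled by \<open>\<eta>\<close>. This is the form that
  Gronwall's inequality takes as input.\<close>

lemma solution_difference_bound:
  assumes x: "x \<in> W" "x0 \<in> W" and T: "T < e" "t \<in> {-T..T}" and "0 \<le> \<eta>"
    and F: "\<And>t. t \<in> {-T..T} \<Longrightarrow> norm (F (x, t, y (x0, t)) - F (x0, t, y (x0, t))) \<le> \<eta>"
  shows "norm (y (x, t) - y (x0, t)) \<le> (norm (y (x, 0) - y (x0, 0)) + \<eta>) * exp ((L + 1) * T)"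
proof -
  have "norm (y (x, t) - y (x0, t)) \<le> (norm (y (x, 0) - y (x0, 0)) + \<eta>) * exp ((L + 1) * \<bar>t - 0\<bar>)"
  proof (rule norm_le_gronwall[OF L_nonneg \<open>0 \<le> \<eta>\<close> solution_difference_derivative[OF x]])
    fix s assume s: "s \<in> closed_segment 0 t"
    then show "s \<in> I" using segment_in_I T by blast
    have "norm (F (x, s, y (x, s)) - F (x, s, y (x0, s))) \<le> L * norm (y (x, s) - y (x0, s))"
      using x \<open>s \<in> I\<close> by (intro lipschitz solution_in)
    with F[of s] segment_in_I[OF T s]
    show "norm (F (x, s, y (x, s)) - F (x0, s, y (x0, s))) \<le> L * norm (y (x, s) - y (x0, s)) + \<eta>"
      by (smt (verit) norm_diff_triangle_ineq diff_add_cancel norm_triangle_ineq add_diff_eq)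
  qed
  also have "\<dots> \<le> (norm (y (x, 0) - y (x0, 0)) + \<eta>) * exp ((L + 1) * T)"
    using T L_nonneg \<open>0 \<le> \<eta>\<close> by (intro mult_left_mono) (auto intro!: mult_left_mono)
  finally show ?thesis .
qed

text \<open>Uniform continuity of \<open>F\<close> along the compact trajectory of
  \<open>x0\<close>, with the parameter in a closed ball, bounds the effect of changing the
  parameter for all times at once.\<close>

lemma continuous_in_parameter_uniformly:
  assumes F: "continuous_on (W \<times> I \<times> V) F" and y0: "continuous_on W (\<lambda>x. y (x, 0))"
    and x0: "x0 \<in> W" and T: "0 \<le> T" "T < e" and \<eta>: "\<eta> > 0"
  obtains \<delta> where "\<delta> > 0"
    "\<And>x t. norm (x - x0) < \<delta> \<Longrightarrow> t \<in> {-T..T} \<Longrightarrow> x \<in> W \<and> norm (y (x, t) - y (x0, t)) \<le> \<eta>"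
proof -
  define B where "B = exp ((L + 1) * T)"
  \<comment> \<open>The initial values and the forcing each contribute \<open>\<eta>'\<close>, and
    Gronwall's factor \<open>B\<close> multiplies both.\<close>
  define \<eta>' where "\<eta>' = \<eta> / (2 * B)"
  have B: "B > 0" and \<eta>': "\<eta>' > 0" using \<eta> by (simp_all add: B_def \<eta>'_def)
  obtain r where r: "r > 0" "cball x0 r \<subseteq> W"
    using open_W x0 open_contains_cball by blast
  have "continuous_on (cball x0 r \<times> {-T..T}) (\<lambda>(x, t). F (x, t, y (x0, t)))"
    unfolding case_prod_beta
    using r T x0 by (intro continuous_on_compose2[OF F] continuous_on_Pair continuous_on_fst continuous_on_snd
        continuous_on_id continuous_on_compose2[OF continuous_on_solution[OF x0]]) (auto intro!: solution_in)
  then have uc: "uniformly_continuous_on (cball x0 r \<times> {-T..T}) (\<lambda>(x, t). F (x, t, y (x0, t)))"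
    by (intro compact_uniformly_continuous compact_Times) auto
  obtain d where d: "d > 0"
    "\<And>p q. p \<in> cball x0 r \<times> {-T..T} \<Longrightarrow> q \<in> cball x0 r \<times> {-T..T} \<Longrightarrow> dist q p < d \<Longrightarrow>
      dist (case q of (x, t) \<Rightarrow> F (x, t, y (x0, t))) (case p of (x, t) \<Rightarrow> F (x, t, y (x0, t))) < \<eta>'"
    using uniformly_continuous_onE[OF uc \<eta>'] by blast
  obtain d' where d': "d' > 0" "\<And>x. x \<in> W \<Longrightarrow> dist x x0 < d' \<Longrightarrow> dist (y (x, 0)) (y (x0, 0)) < \<eta>'"
    using y0 x0 \<eta>' unfolding continuous_on_iff by metis
  show thesis
  proof (rule that[of "min r (min d d')"])
    show "min r (min d d') > 0" using r d d' by simp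
    fix x t assume x: "norm (x - x0) < min r (min d d')" and t: "t \<in> {-T..T}"
    have xr: "x \<in> cball x0 r" using x by (simp add: dist_norm norm_minus_commute)
    then have xW: "x \<in> W" using r by blast
    have "norm (y (x, t) - y (x0, t)) \<le> (norm (y (x, 0) - y (x0, 0)) + \<eta>') * exp ((L + 1) * T)"
    proof (rule solution_difference_bound[OF xW x0 T(2) t])
      fix s assume "s \<in> {-T..T}"
      then show "norm (F (x, s, y (x0, s)) - F (x0, s, y (x0, s))) \<le> \<eta>'"
        using d(2)[of "(x0, s)" "(x, s)"] x xr r by (auto simp: dist_Pair_Pair dist_norm)
    qed (use \<eta>' in simp)
    also have "\<dots> \<le> (\<eta>' + \<eta>') * B"
      unfolding B_def using d'(2)[OF xW] x by (intro mult_right_mono) (auto simp: dist_norm)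
    also have "\<dots> = \<eta>" using B by (simp add: \<eta>'_def)
    finally show "x \<in> W \<and> norm (y (x, t) - y (x0, t)) \<le> \<eta>" using xW by simp
  qed
qed

lemma continuous_solution:
  assumes F: "continuous_on (W \<times> I \<times> V) F" and y0: "continuous_on W (\<lambda>x. y (x, 0))"
  shows "continuous_on (W \<times> I) y"
  unfolding continuous_on_iff
proof safe
  fix x0 t0 and \<eta> :: real assume x0: "x0 \<in> W" and t0: "t0 \<in> I" and \<eta>: "\<eta> > 0"
  \<comment> \<open>Midway between the absolute value of \<open>t0\<close> and \<open>e\<close>, so
    that \<open>t0\<close> is interior to a compact interval inside \<open>I\<close>.\<close>
  define T where "T = (\<bar>t0\<bar> + e) / 2"
  have T: "0 \<le> T" "T < e" "\<bar>t0\<bar> < T" using t0 by (auto simp: T_def)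
  obtain d where d: "d > 0"
    "\<And>x t. norm (x - x0) < d \<Longrightarrow> t \<in> {-T..T} \<Longrightarrow> x \<in> W \<and> norm (y (x, t) - y (x0, t)) \<le> \<eta> / 2"
    using continuous_in_parameter_uniformly[OF F y0 x0 T(1,2), of "\<eta> / 2"] \<eta> by auto
  obtain d' where d': "d' > 0" "\<And>t. t \<in> I \<Longrightarrow> dist t t0 < d' \<Longrightarrow> dist (y (x0, t)) (y (x0, t0)) < \<eta> / 2"
    using continuous_on_solution[OF x0] t0 \<eta> unfolding continuous_on_iff by (metis half_gt_zero)
  show "\<exists>d>0. \<forall>p\<in>W \<times> I. dist p (x0, t0) < d \<longrightarrow> dist (y p) (y (x0, t0)) < \<eta>"
  proof (intro exI[of _ "min d (min d' (T - \<bar>t0\<bar>))"] conjI ballI impI)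
    show "0 < min d (min d' (T - \<bar>t0\<bar>))" using d d' T by simp
    fix p assume p: "p \<in> W \<times> I" "dist p (x0, t0) < min d (min d' (T - \<bar>t0\<bar>))"
    obtain x t where xt: "p = (x, t)" by (cases p)
    have "dist x x0 \<le> dist p (x0, t0)" "dist t t0 \<le> dist p (x0, t0)"
      using dist_fst_le[of p "(x0, t0)"] dist_snd_le[of p "(x0, t0)"] by (simp_all add: xt)
    with p(2) have "norm (x - x0) < d" "dist t t0 < d'" "\<bar>t - t0\<bar> < T - \<bar>t0\<bar>"
      by (auto simp: dist_norm dist_real_def)
    moreover from this have "t \<in> {-T..T}" by auto
    ultimately have "dist (y (x, t)) (y (x0, t)) \<le> \<eta> / 2" "dist (y (x0, t)) (y (x0, t0)) < \<eta> / 2"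
      using d(2)[of x t] d'(2)[of t] p(1) by (auto simp: dist_norm xt)
    then show "dist (y p) (y (x0, t0)) < \<eta>"
      using dist_triangle[of "y (x, t)" "y (x0, t0)" "y (x0, t)"] by (simp add: xt)
  qed
qed

section \<open>First order estimates along a trajectory\<close>

lemma frechet_derivative_linear:
  assumes "Ck_on (Suc 0) (W \<times> I \<times> V) F" "x \<in> W" "t \<in> I"
  shows "linear (D x t)"
  using assms solution_in[of x t]
  by (intro has_derivative_linear[OF Ck_on_Suc_has_derivative[of 0 "W \<times> I \<times> V"]]) auto

text \<open>This drives the Gronwall estimates for the difference quotients, and it makes the
  variational equation Lipschitz in the state with the same constant.\<close>

lemma frechet_derivative_state_bound:
  assumes "Ck_on (Suc 0) (W \<times> I \<times> V) F" "x \<in> W" "t \<in> I"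
  shows "norm (D x t (0, 0, w)) \<le> L * norm w"
proof (rule has_derivative_norm_le_Lipschitz[OF _ open_V])
  show "y (x, t) \<in> V" using assms solution_in by simp
  have "(F has_derivative D x t) (at (x, t, y (x, t)))"
    using assms solution_in[of x t] by (intro Ck_on_Suc_has_derivative[of 0 "W \<times> I \<times> V"]) auto
  then show "((\<lambda>w. F (x, t, w)) has_derivative (\<lambda>h. D x t (0, 0, h))) (at (y (x, t)))"
    by (intro has_derivative_compose[of "\<lambda>w. (x, t, w)" "\<lambda>h. (0, 0, h)" _ UNIV F])
      (auto intro!: derivative_eq_intros)
  show "norm (F (x, t, w) - F (x, t, y (x, t))) \<le> L * norm (w - y (x, t))" if "w \<in> V" for w
    using assms that by (intro lipschitz solution_in)
qed

lemma compact_trajectory: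
  assumes "x \<in> W" "T < e"
  shows "compact ((\<lambda>t. (x, t, y (x, t))) ` {-T..T})" "(\<lambda>t. (x, t, y (x, t))) ` {-T..T} \<subseteq> W \<times> I \<times> V"
proof -
  have "continuous_on {-T..T} (\<lambda>t. y (x, t))"
    using assms by (intro continuous_on_subset[OF continuous_on_solution]) auto
  then show "compact ((\<lambda>t. (x, t, y (x, t))) ` {-T..T})"
    by (intro compact_continuous_image continuous_on_Pair continuous_on_const continuous_on_id) auto
  show "(\<lambda>t. (x, t, y (x, t))) ` {-T..T} \<subseteq> W \<times> I \<times> V"
    using assms by (auto intro!: solution_in)
qed

text \<open>An a priori bound: Taylor errors are measured by the joint increment of \<open>x\<close>
  and \<open>y\<close>, and this estimate makes the increment of \<open>y\<close> comparable to that
  of \<open>x\<close>.\<close>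

lemma lipschitz_in_parameter:
  assumes F: "Ck_on (Suc 0) (W \<times> I \<times> V) F" and y0: "((\<lambda>x. y (x, 0)) has_derivative Y0) (at x0)"
    and x0: "x0 \<in> W" and T: "0 \<le> T" "T < e"
  obtains C \<delta> where "C \<ge> 0" "\<delta> > 0"
    "\<And>x t. norm (x - x0) < \<delta> \<Longrightarrow> t \<in> {-T..T} \<Longrightarrow> x \<in> W \<and> norm (y (x, t) - y (x0, t)) \<le> C * norm (x - x0)"
proof -
  let ?K = "(\<lambda>t. (x0, t, y (x0, t))) ` {-T..T}"
  note K = compact_trajectory[OF x0 T(2)]
  obtain d where d: "d > 0"
    "\<And>p q. p \<in> ?K \<Longrightarrow> norm (q - p) < d \<Longrightarrow> q \<in> W \<times> I \<times> V \<and>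
      norm (F q - F p - frechet_derivative F (at p) (q - p)) \<le> 1 * norm (q - p)"
    using Ck_1_uniformly_differentiable_on_compact[OF open_domain F K zero_less_one] by blast
  have "continuous_on ?K (\<lambda>p. \<Sum>i\<in>Basis. norm (frechet_derivative F (at p) i))"
    by (intro continuous_intros continuous_on_subset[OF _ K(2)]
        Ck_on_imp_continuous_on[OF Ck_on_Suc_frechet_derivative[OF F]])
  then have "bounded ((\<lambda>p. \<Sum>i\<in>Basis. norm (frechet_derivative F (at p) i)) ` ?K)"
    by (intro compact_imp_bounded compact_continuous_image[OF _ K(1)])
  then obtain M where "\<forall>t\<in>{-T..T}. (\<Sum>i\<in>Basis. norm (D x0 t i)) \<le> M"
    unfolding bounded_iff by (auto simp: sum_nonneg)
  then have M: "(\<Sum>i\<in>Basis. norm (D x0 t i)) \<le> M" if "t \<in> {-T..T}" for t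
    using that by blast
  have D: "norm (D x0 t v) \<le> M * norm v" if t: "t \<in> {-T..T}" for t v
  proof -
    have "D x0 t v = (\<Sum>i\<in>Basis. (v \<bullet> i) *\<^sub>R D x0 t i)"
      using T t by (intro linear_eq_sum_Basis frechet_derivative_linear[OF F x0]) auto
    also have "norm \<dots> \<le> (\<Sum>i\<in>Basis. norm v * norm (D x0 t i))"
      by (intro sum_norm_le) (simp add: Basis_le_norm mult_right_mono)
    also have "\<dots> \<le> norm v * M"
      unfolding sum_distrib_left[symmetric] by (intro mult_left_mono M t) simp
    finally show ?thesis by (simp add: mult.commute)
  qed
  have "M \<ge> 0"
    using order_trans[OF sum_nonneg M[of 0]] T by simp
  obtain C d' where C: "C \<ge> 0" "d' > 0"
    "\<And>x. norm (x - x0) < d' \<Longrightarrow> norm (y (x, 0) - y (x0, 0)) \<le> C * norm (x - x0)"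
    using has_derivative_imp_local_Lipschitz[OF y0] by blast
  show thesis
  proof (rule that[of "(C + (M + 1)) * exp ((L + 1) * T)" "min d d'"])
    fix x t assume x: "norm (x - x0) < min d d'" and t: "t \<in> {-T..T}"
    have near: "norm ((x, s, y (x0, s)) - (x0, s, y (x0, s))) < d" for s
      using x by (simp add: norm_Pair)
    have xW: "x \<in> W"
      using d(2)[of "(x0, t, y (x0, t))", OF _ near] t by auto
    \<comment> \<open>\<open>M\<close> bounds the linear part along the trajectory, and the extra 1
      is the Taylor remainder, taken with relative error 1.\<close>
    have "norm (y (x, t) - y (x0, t)) \<le> (norm (y (x, 0) - y (x0, 0)) + (M + 1) * norm (x - x0)) * exp ((L + 1) * T)"
    proof (rule solution_difference_bound[OF xW x0 T(2) t])
      fix s assume s: "s \<in> {-T..T}"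
      have "norm (F (x, s, y (x0, s)) - F (x0, s, y (x0, s)) - D x0 s (x - x0, 0, 0)) \<le> norm (x - x0)"
        using d(2)[of "(x0, s, y (x0, s))", OF _ near] s by (auto simp: norm_Pair zero_prod_def)
      then show "norm (F (x, s, y (x0, s)) - F (x0, s, y (x0, s))) \<le> (M + 1) * norm (x - x0)"
        using D[OF s, of "(x - x0, 0, 0)"]
          norm_triangle_ineq2[of "F (x, s, y (x0, s)) - F (x0, s, y (x0, s))" "D x0 s (x - x0, 0, 0)"]
        by (simp add: norm_Pair algebra_simps)
    qed (use \<open>M \<ge> 0\<close> in simp)
    also have "\<dots> \<le> (C * norm (x - x0) + (M + 1) * norm (x - x0)) * exp ((L + 1) * T)"
      using C(3) x by (intro mult_right_mono add_right_mono) auto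
    finally show "x \<in> W \<and> norm (y (x, t) - y (x0, t)) \<le> (C + (M + 1)) * exp ((L + 1) * T) * norm (x - x0)"
      using xW by (simp add: algebra_simps)
  qed (use C d \<open>M \<ge> 0\<close> in auto)
qed

lemma linearization_remainder:
  assumes F: "Ck_on (Suc 0) (W \<times> I \<times> V) F" and y0: "((\<lambda>x. y (x, 0)) has_derivative Y0) (at x0)"
    and x0: "x0 \<in> W" and T: "0 \<le> T" "T < e" and \<eta>: "\<eta> > 0"
  obtains \<delta> where "\<delta> > 0"
    "\<And>x t. norm (x - x0) < \<delta> \<Longrightarrow> t \<in> {-T..T} \<Longrightarrow> x \<in> W \<and>
      norm (F (x, t, y (x, t)) - F (x0, t, y (x0, t)) - D x0 t (x - x0, 0, y (x, t) - y (x0, t)))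
        \<le> \<eta> * norm (x - x0)"
proof -
  let ?K = "(\<lambda>t. (x0, t, y (x0, t))) ` {-T..T}"
  note K = compact_trajectory[OF x0 T(2)]
  obtain C d where C: "C \<ge> 0" "d > 0"
    "\<And>x t. norm (x - x0) < d \<Longrightarrow> t \<in> {-T..T} \<Longrightarrow> x \<in> W \<and> norm (y (x, t) - y (x0, t)) \<le> C * norm (x - x0)"
    using lipschitz_in_parameter[OF F y0 x0 T] by blast
  \<comment> \<open>The joint increment of parameter and state is at most
    \<open>(1 + C) * norm (x - x0)\<close>, so this factor is divided out beforehand.\<close>
  define \<eta>' where "\<eta>' = \<eta> / (1 + C)"
  have \<eta>': "\<eta>' > 0" using C \<eta> by (simp add: \<eta>'_def add_pos_nonneg)
  obtain d' where d': "d' > 0"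
    "\<And>p q. p \<in> ?K \<Longrightarrow> norm (q - p) < d' \<Longrightarrow> q \<in> W \<times> I \<times> V \<and>
      norm (F q - F p - frechet_derivative F (at p) (q - p)) \<le> \<eta>' * norm (q - p)"
    using Ck_1_uniformly_differentiable_on_compact[OF open_domain F K \<eta>'] by blast
  show thesis
  proof (rule that[of "min d (d' / (1 + C))"])
    show "min d (d' / (1 + C)) > 0" using C d' by (simp add: add_pos_nonneg)
    fix x t assume x: "norm (x - x0) < min d (d' / (1 + C))" and t: "t \<in> {-T..T}"
    have y: "x \<in> W" "norm (y (x, t) - y (x0, t)) \<le> C * norm (x - x0)"
      using C(3)[of x t] x t by auto
    have "norm ((x - x0, 0 :: real, y (x, t) - y (x0, t))) \<le> norm (x - x0) + norm (y (x, t) - y (x0, t))"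
      using norm_Pair_le[of "x - x0" "(0 :: real, y (x, t) - y (x0, t))"] by (simp add: norm_Pair)
    also have "\<dots> \<le> (1 + C) * norm (x - x0)"
      using y by (simp add: algebra_simps)
    finally have n: "norm ((x, t, y (x, t)) - (x0, t, y (x0, t))) \<le> (1 + C) * norm (x - x0)"
      by simp
    also have "\<dots> < d'"
      using x C by (simp add: pos_less_divide_eq add_pos_nonneg mult.commute)
    finally have "norm (F (x, t, y (x, t)) - F (x0, t, y (x0, t)) - D x0 t (x - x0, 0, y (x, t) - y (x0, t)))
        \<le> \<eta>' * norm ((x, t, y (x, t)) - (x0, t, y (x0, t)))"
      using d'(2)[of "(x0, t, y (x0, t))" "(x, t, y (x, t))"] t by auto
    also have "\<dots> \<le> \<eta>' * ((1 + C) * norm (x - x0))"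
      using n \<eta>' by (intro mult_left_mono) auto
    also have "\<dots> = \<eta> * norm (x - x0)"
      using C by (simp add: \<eta>'_def)
    finally show "x \<in> W \<and>
      norm (F (x, t, y (x, t)) - F (x0, t, y (x0, t)) - D x0 t (x - x0, 0, y (x, t) - y (x0, t)))
        \<le> \<eta> * norm (x - x0)" using y by simp
  qed
qed

section \<open>Difference quotients and the variational equation\<close>

definition diff_quotient where
  "diff_quotient x0 v h t = (y (x0 + h *\<^sub>R v, t) - y (x0, t)) /\<^sub>R h"

text \<open>A difference quotient solves the variational equation up to an error. The smallness
  condition involves step and direction only through \<open>h * norm v\<close>, and the errors are
  proportional to \<open>norm v\<close>: this uniformity over directions is what later yields a
  Frechet derivative and not merely directional ones.\<close>

lemma diff_quotient_derivative:
  assumes F: "Ck_on (Suc 0) (W \<times> I \<times> V) F" and y0: "((\<lambda>x. y (x, 0)) has_derivative Y0) (at x0)"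
    and x0: "x0 \<in> W" and T: "0 \<le> T" "T < e" and \<eta>: "\<eta> > 0"
  obtains \<delta> where "\<delta> > 0"
    "\<And>(v :: 'p) h t. 0 < h \<Longrightarrow> h * norm v < \<delta> \<Longrightarrow> t \<in> {-T..T} \<Longrightarrow>
      \<exists>q'. (diff_quotient x0 v h has_vector_derivative q') (at t) \<and>
        norm (q' - D x0 t (v, 0, diff_quotient x0 v h t)) \<le> \<eta> * norm v"
    "\<And>(v :: 'p) h. 0 < h \<Longrightarrow> h * norm v < \<delta> \<Longrightarrow> x0 + h *\<^sub>R v \<in> W \<and> norm (diff_quotient x0 v h 0 - Y0 v) \<le> \<eta> * norm v"
proof -
  obtain d where d: "d > 0"
    "\<And>x t. norm (x - x0) < d \<Longrightarrow> t \<in> {-T..T} \<Longrightarrow> x \<in> W \<and>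
      norm (F (x, t, y (x, t)) - F (x0, t, y (x0, t)) - D x0 t (x - x0, 0, y (x, t) - y (x0, t)))
        \<le> \<eta> * norm (x - x0)"
    using linearization_remainder[OF F y0 x0 T \<eta>] by blast
  obtain d' where d': "d' > 0"
    "\<And>x. norm (x - x0) < d' \<Longrightarrow> norm (y (x, 0) - y (x0, 0) - Y0 (x - x0)) \<le> \<eta> * norm (x - x0)"
    using y0 \<eta> unfolding has_derivative_at_alt by blast
  show thesis
  proof (rule that[of "min d d'"])
    show "min d d' > 0" using d d' by simp
    fix v :: 'p and h assume h: "0 < h" "h * norm v < min d d'"
    define x where "x = x0 + h *\<^sub>R v"
    have x: "norm (x - x0) = h * norm v" "x - x0 = h *\<^sub>R v"
      using h by (simp_all add: x_def)
    then have xW: "x \<in> W" using d(2)[of x 0] T h by simp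
    have scale: "norm (a /\<^sub>R h - b) \<le> \<eta> * norm v" if "norm (a - h *\<^sub>R b) \<le> \<eta> * norm (x - x0)" for a b :: 'y
    proof -
      have "a /\<^sub>R h - b = (a - h *\<^sub>R b) /\<^sub>R h"
        using h by (simp add: scaleR_diff_right)
      then have "norm (a /\<^sub>R h - b) = norm (a - h *\<^sub>R b) / h"
        using h by (simp add: divide_inverse mult.commute)
      also have "\<dots> \<le> \<eta> * norm (x - x0) / h"
        using that h by (intro divide_right_mono) auto
      finally show ?thesis using x h by simp
    qed
    have "h *\<^sub>R Y0 v = Y0 (h *\<^sub>R v)"
      using y0 by (simp add: linear_cmul has_derivative_linear)
    then show "x0 + h *\<^sub>R v \<in> W \<and> norm (diff_quotient x0 v h 0 - Y0 v) \<le> \<eta> * norm v"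
      using xW d'(2)[of x] x h scale[of "y (x, 0) - y (x0, 0)" "Y0 v"] by (simp add: diff_quotient_def x_def)
    fix t assume t: "t \<in> {-T..T}"
    have tI: "t \<in> I" using t T by auto
    have hD: "h *\<^sub>R D x0 t (v, 0, diff_quotient x0 v h t) = D x0 t (x - x0, 0, y (x, t) - y (x0, t))"
      using h x by (simp add: linear_cmul[OF frechet_derivative_linear[OF F x0 tI], symmetric] diff_quotient_def x_def)
    let ?q' = "(F (x, t, y (x, t)) - F (x0, t, y (x0, t))) /\<^sub>R h"
    show "\<exists>q'. (diff_quotient x0 v h has_vector_derivative q') (at t) \<and>
        norm (q' - D x0 t (v, 0, diff_quotient x0 v h t)) \<le> \<eta> * norm v"
    proof (intro exI[of _ ?q'] conjI)
      show "(diff_quotient x0 v h has_vector_derivative ?q') (at t)"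
        unfolding diff_quotient_def[abs_def] x_def[symmetric]
        by (intro bounded_linear.has_vector_derivative[OF bounded_linear_scaleR_right]
            solution_difference_derivative xW x0 tI)
      show "norm (?q' - D x0 t (v, 0, diff_quotient x0 v h t)) \<le> \<eta> * norm v"
        using d(2)[of x t] x h t by (intro scale) (simp add: hD)
    qed
  qed
qed

lemma variation_split:
  assumes "Ck_on (Suc 0) (W \<times> I \<times> V) F" "x \<in> W" "t \<in> I"
  shows "D x t (v, 0, a) - D x t (v', 0, a') = D x t (v - v', 0, a - a')"
  using linear_diff[OF frechet_derivative_linear[OF assms], of "(v, 0, a)" "(v', 0, a')"] by simp

text \<open>Two quotients in the same direction approximately solve the same linear equation, so
  their difference is governed by Gronwall's inequality with constant \<open>L\<close>.\<close>

lemma diff_quotient_Cauchy: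
  assumes F: "Ck_on (Suc 0) (W \<times> I \<times> V) F" and y0: "((\<lambda>x. y (x, 0)) has_derivative Y0) (at x0)"
    and x0: "x0 \<in> W" and T: "0 \<le> T" "T < e" and \<eta>: "\<eta> > 0"
  obtains \<delta> where "\<delta> > 0"
    "\<And>(v :: 'p) h h' t. 0 < h \<Longrightarrow> h * norm v < \<delta> \<Longrightarrow> 0 < h' \<Longrightarrow> h' * norm v < \<delta> \<Longrightarrow> t \<in> {-T..T} \<Longrightarrow>
      norm (diff_quotient x0 v h t - diff_quotient x0 v h' t) \<le> \<eta> * norm v"
proof -
  define B where "B = exp ((L + 1) * T)"
  \<comment> \<open>Forcing and initial values each carry the errors of both quotients, giving four
    terms \<open>\<eta>' * norm v\<close>, all multiplied by at most \<open>B\<close>.\<close>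
  define \<eta>' where "\<eta>' = \<eta> / (4 * B)"
  have B: "B > 0" and \<eta>': "\<eta>' > 0" using \<eta> by (simp_all add: B_def \<eta>'_def)
  obtain d where d: "d > 0"
    "\<And>(v :: 'p) h t. 0 < h \<Longrightarrow> h * norm v < d \<Longrightarrow> t \<in> {-T..T} \<Longrightarrow>
      \<exists>q'. (diff_quotient x0 v h has_vector_derivative q') (at t) \<and>
        norm (q' - D x0 t (v, 0, diff_quotient x0 v h t)) \<le> \<eta>' * norm v"
    "\<And>(v :: 'p) h. 0 < h \<Longrightarrow> h * norm v < d \<Longrightarrow> x0 + h *\<^sub>R v \<in> W \<and> norm (diff_quotient x0 v h 0 - Y0 v) \<le> \<eta>' * norm v"
    using diff_quotient_derivative[OF F y0 x0 T \<eta>'] by blast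
  show thesis
  proof (rule that[OF d(1)])
    fix v :: 'p and h h' t
    assume h: "0 < h" "h * norm v < d" and h': "0 < h'" "h' * norm v < d" and t: "t \<in> {-T..T}"
    let ?q = "diff_quotient x0 v"
    obtain q1 where q1: "\<And>s. s \<in> {-T..T} \<Longrightarrow> (?q h has_vector_derivative q1 s) (at s)"
      "\<And>s. s \<in> {-T..T} \<Longrightarrow> norm (q1 s - D x0 s (v, 0, ?q h s)) \<le> \<eta>' * norm v"
      using d(2)[OF h] by metis
    obtain q2 where q2: "\<And>s. s \<in> {-T..T} \<Longrightarrow> (?q h' has_vector_derivative q2 s) (at s)"
      "\<And>s. s \<in> {-T..T} \<Longrightarrow> norm (q2 s - D x0 s (v, 0, ?q h' s)) \<le> \<eta>' * norm v"
      using d(2)[OF h'] by metis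
    have "norm (?q h t - ?q h' t)
      \<le> (norm (?q h 0 - ?q h' 0) + 2 * \<eta>' * norm v) * exp ((L + 1) * \<bar>t - 0\<bar>)"
    proof (rule norm_le_gronwall[OF L_nonneg _ has_vector_derivative_diff[OF q1(1) q2(1)]])
      fix s assume "s \<in> closed_segment 0 t"
      then have s: "s \<in> {-T..T}" and sI: "s \<in> I" using segment_in_I[OF T(2) t] by auto
      then show "s \<in> {-T..T}" "s \<in> {-T..T}" by simp_all
      have "norm (D x0 s (v, 0, ?q h s) - D x0 s (v, 0, ?q h' s)) \<le> L * norm (?q h s - ?q h' s)"
        using frechet_derivative_state_bound[OF F x0 sI] by (simp add: variation_split[OF F x0 sI])
      moreover have "norm (q1 s - q2 s) \<le> norm (q1 s - D x0 s (v, 0, ?q h s))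
          + norm (D x0 s (v, 0, ?q h s) - D x0 s (v, 0, ?q h' s)) + norm (q2 s - D x0 s (v, 0, ?q h' s))"
        by norm
      ultimately show "norm (q1 s - q2 s) \<le> L * norm (?q h s - ?q h' s) + 2 * \<eta>' * norm v"
        using q1(2)[OF s] q2(2)[OF s] by linarith
    qed (use \<eta>' in simp)
    also have "\<dots> \<le> (2 * \<eta>' * norm v + 2 * \<eta>' * norm v) * B"
    proof (intro mult_mono add_right_mono)
      show "norm (?q h 0 - ?q h' 0) \<le> 2 * \<eta>' * norm v"
        using d(3)[OF h] d(3)[OF h'] norm_triangle_sub[of "?q h 0 - ?q h' 0" "?q h 0 - Y0 v"]
          norm_triangle_ineq4[of "?q h 0 - Y0 v" "?q h' 0 - Y0 v"] by simp
      show "exp ((L + 1) * \<bar>t - 0\<bar>) \<le> B"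
        unfolding B_def using t L_nonneg by (auto intro!: mult_left_mono)
    qed (use \<eta>' in auto)
    also have "\<dots> = \<eta> * norm v"
      using B by (simp add: \<eta>'_def)
    finally show "norm (?q h t - ?q h' t) \<le> \<eta> * norm v" .
  qed
qed

text \<open>The derivative \<open>z\<close> is built as a limit of difference quotients, which the
  Cauchy estimate provides. Passing to the limit in the approximate equation gives the variational
  equation, uniqueness for that linear equation gives linearity in \<open>v\<close>, and uniformity
  over directions gives Frechet differentiability.\<close>

lemma variational_equation:
  assumes F: "Ck_on (Suc 0) (W \<times> I \<times> V) F" and y0: "((\<lambda>x. y (x, 0)) has_derivative Y0) (at x0)"
    and x0: "x0 \<in> W"
  obtains z where "\<And>t. t \<in> I \<Longrightarrow> ((\<lambda>x. y (x, t)) has_derivative (\<lambda>v. z v t)) (at x0)"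
    "\<And>v t. t \<in> I \<Longrightarrow> (z v has_vector_derivative D x0 t (v, 0, z v t)) (at t)"
proof -
  define h :: "nat \<Rightarrow> real" where "h n = inverse (real (Suc n))" for n
  have h: "h n > 0" for n by (simp add: h_def)
  have h_lim: "(\<lambda>n. h n * c) \<longlonglongrightarrow> 0" for c
    unfolding h_def by (intro tendsto_mult_left_zero LIMSEQ_inverse_real_of_nat)
  have h_small: "\<forall>\<^sub>F n in sequentially. h n * c < d" if "d > 0" for c d
    using order_tendstoD(2)[OF h_lim that] .
  define z where "z v t = lim (\<lambda>n. diff_quotient x0 v (h n) t)" for v t
  have lim: "(\<lambda>n. diff_quotient x0 v (h n) t) \<longlonglongrightarrow> z v t" if "t \<in> I" for v t
  proof -
    have tI: "0 \<le> \<bar>t\<bar>" "\<bar>t\<bar> < e" using that by auto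
    have "Cauchy (\<lambda>n. diff_quotient x0 v (h n) t)"
    proof (rule metric_CauchyI)
      fix \<eta> :: real assume "\<eta> > 0"
      define \<eta>' where "\<eta>' = \<eta> / (1 + norm v)"
      have \<eta>': "\<eta>' > 0" using \<open>\<eta> > 0\<close> by (simp add: \<eta>'_def add_pos_nonneg)
      have \<eta>'v: "\<eta>' * norm v < \<eta>" using \<open>\<eta> > 0\<close> by (simp add: \<eta>'_def field_simps add_pos_nonneg)
      obtain d where d: "d > 0" "\<And>(v :: 'p) h h' s. 0 < h \<Longrightarrow> h * norm v < d \<Longrightarrow> 0 < h' \<Longrightarrow> h' * norm v < d \<Longrightarrow>
          s \<in> {-\<bar>t\<bar>..\<bar>t\<bar>} \<Longrightarrow> norm (diff_quotient x0 v h s - diff_quotient x0 v h' s) \<le> \<eta>' * norm v"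
        using diff_quotient_Cauchy[OF F y0 x0 tI \<eta>'] by blast
      obtain N where N: "\<And>n. n \<ge> N \<Longrightarrow> h n * norm v < d"
        using h_small[OF d(1)] unfolding eventually_sequentially by blast
      have "dist (diff_quotient x0 v (h m) t) (diff_quotient x0 v (h n) t) < \<eta>" if "m \<ge> N" "n \<ge> N" for m n
        using d(2)[OF h N[OF that(1)] h N[OF that(2)], of t] \<eta>'v abs_ge_minus_self[of t] abs_ge_self[of t]
        by (simp add: dist_norm)
      then show "\<exists>N. \<forall>m\<ge>N. \<forall>n\<ge>N. dist (diff_quotient x0 v (h m) t) (diff_quotient x0 v (h n) t) < \<eta>"
        by blast
    qed
    then show ?thesis
      unfolding z_def by (simp add: Cauchy_convergent_iff convergent_LIMSEQ_iff)
  qed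
  \<comment> \<open>Letting one of the two steps in the Cauchy estimate tend to zero replaces its
    quotient by \<open>z\<close>, with the same uniformity in \<open>v\<close>.\<close>
  have approx: "\<exists>d>0. \<forall>v::'p. \<forall>k t. 0 < k \<longrightarrow> k * norm v < d \<longrightarrow> t \<in> {-T..T} \<longrightarrow>
      norm (diff_quotient x0 v k t - z v t) \<le> \<eta> * norm v"
    if T: "0 \<le> T" "T < e" and \<eta>: "\<eta> > 0" for T \<eta>
  proof -
    obtain d where d: "d > 0" "\<And>(v :: 'p) h h' s. 0 < h \<Longrightarrow> h * norm v < d \<Longrightarrow> 0 < h' \<Longrightarrow> h' * norm v < d \<Longrightarrow>
        s \<in> {-T..T} \<Longrightarrow> norm (diff_quotient x0 v h s - diff_quotient x0 v h' s) \<le> \<eta> * norm v"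
      using diff_quotient_Cauchy[OF F y0 x0 T \<eta>] by auto
    have "norm (diff_quotient x0 v k t - z v t) \<le> \<eta> * norm v"
      if k: "0 < k" "k * norm v < d" and t: "t \<in> {-T..T}" for v k t
    proof (rule tendsto_upperbound)
      show "(\<lambda>n. norm (diff_quotient x0 v k t - diff_quotient x0 v (h n) t)) \<longlonglongrightarrow>
          norm (diff_quotient x0 v k t - z v t)"
        using t T by (intro tendsto_intros lim) auto
      show "\<forall>\<^sub>F n in sequentially. norm (diff_quotient x0 v k t - diff_quotient x0 v (h n) t) \<le> \<eta> * norm v"
        using h_small[OF d(1), of "norm v"] by eventually_elim (use d(2)[OF k h _ t] in auto)
    qed simp
    with d(1) show ?thesis by blast
  qed
  have ode: "(z v has_vector_derivative D x0 t (v, 0, z v t)) (at t)" if t: "t \<in> I" for v t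
  proof -
    define T where "T = (\<bar>t\<bar> + e) / 2"
    have T: "0 \<le> T" "T < e" "\<bar>t\<bar> < T" using t by (auto simp: T_def)
    let ?S = "{-T<..<T}"
    obtain d where d: "d > 0" "\<And>(v :: 'p) h s. 0 < h \<Longrightarrow> h * norm v < d \<Longrightarrow> s \<in> {-T..T} \<Longrightarrow>
        \<exists>q'. (diff_quotient x0 v h has_vector_derivative q') (at s) \<and>
          norm (q' - D x0 s (v, 0, diff_quotient x0 v h s)) \<le> 1 * norm v"
        "\<And>(v :: 'p) h. 0 < h \<Longrightarrow> h * norm v < d \<Longrightarrow> x0 + h *\<^sub>R v \<in> W \<and> norm (diff_quotient x0 v h 0 - Y0 v) \<le> 1 * norm v"
      using diff_quotient_derivative[OF F y0 x0 T(1,2) zero_less_one] by blast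
    \<comment> \<open>Discarding the first \<open>N\<close> steps leaves quotients whose displaced
      parameter lies in \<open>W\<close>, so that each of them is differentiable on the whole
      interval.\<close>
    obtain N where N: "\<And>n. n \<ge> N \<Longrightarrow> h n * norm v < d"
      using h_small[OF d(1)] unfolding eventually_sequentially by blast
    define q where "q n = diff_quotient x0 v (h (n + N))" for n
    have q: "(q n has_vector_derivative vector_derivative (q n) (at s)) (at s)" if "s \<in> ?S" for n s
    proof -
      have "\<exists>q'. (q n has_vector_derivative q') (at s)"
        using d(2)[OF h N, of "n + N" s] that unfolding q_def by auto
      then show ?thesis by (metis vector_derivative_at)
    qed
    have q_lim: "(\<lambda>n. q n s) \<longlonglongrightarrow> z v s" if "s \<in> ?S" for s
      unfolding q_def using that T by (intro LIMSEQ_ignore_initial_segment[OF lim]) auto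
    \<comment> \<open>Termwise differentiation: the quotients converge pointwise and their
      derivatives uniformly.\<close>
    have "\<exists>g. \<forall>s\<in>?S. (\<lambda>n. q n s) \<longlonglongrightarrow> g s \<and> (g has_derivative (\<lambda>r. r *\<^sub>R D x0 s (v, 0, z v s))) (at s within ?S)"
    proof (rule has_derivative_sequence[OF _ _ _ _ q_lim])
      show "(q n has_derivative (\<lambda>r. r *\<^sub>R vector_derivative (q n) (at s))) (at s within ?S)" if "s \<in> ?S" for n s
        using q[OF that, of n] by (auto simp: has_vector_derivative_def intro: has_derivative_at_withinI)
      show "t \<in> ?S" "t \<in> ?S" using T by auto
      fix \<epsilon> :: real assume "\<epsilon> > 0"
      \<comment> \<open>One \<open>\<eta> * norm v\<close> comes from the approximate equation, and
        \<open>L\<close> times that from replacing \<open>q n\<close> by \<open>z\<close> in it;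
        \<open>1 + norm v\<close> avoids a division by zero.\<close>
      define \<eta> where "\<eta> = \<epsilon> / ((1 + L) * (1 + norm v))"
      have \<eta>: "\<eta> > 0" using \<open>\<epsilon> > 0\<close> L_nonneg by (simp add: \<eta>_def add_pos_nonneg)
      have "\<eta> * (1 + L) * norm v \<le> \<eta> * (1 + L) * (1 + norm v)"
        using \<eta> L_nonneg by (intro mult_left_mono) auto
      also have "\<dots> = \<epsilon>"
        using L_nonneg add_pos_nonneg[of 1 "norm v"] by (simp add: \<eta>_def add_nonneg_eq_0_iff)
      finally have \<epsilon>: "\<eta> * (1 + L) * norm v \<le> \<epsilon>" .
      obtain d1 where d1: "d1 > 0" "\<And>(v :: 'p) h s. 0 < h \<Longrightarrow> h * norm v < d1 \<Longrightarrow> s \<in> {-T..T} \<Longrightarrow>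
          \<exists>q'. (diff_quotient x0 v h has_vector_derivative q') (at s) \<and>
            norm (q' - D x0 s (v, 0, diff_quotient x0 v h s)) \<le> \<eta> * norm v"
          "\<And>(v :: 'p) h. 0 < h \<Longrightarrow> h * norm v < d1 \<Longrightarrow> x0 + h *\<^sub>R v \<in> W \<and> norm (diff_quotient x0 v h 0 - Y0 v) \<le> \<eta> * norm v"
        using diff_quotient_derivative[OF F y0 x0 T(1,2) \<eta>] by blast
      obtain d2 where d2: "d2 > 0" "\<And>(v :: 'p) k s. 0 < k \<Longrightarrow> k * norm v < d2 \<Longrightarrow> s \<in> {-T..T} \<Longrightarrow>
          norm (diff_quotient x0 v k s - z v s) \<le> \<eta> * norm v"
        using approx[OF T(1,2) \<eta>] by blast
      have "\<forall>\<^sub>F n in sequentially. h n * norm v < min d1 d2"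
        using d1 d2 by (intro h_small) auto
      then have "\<forall>\<^sub>F n in sequentially. h (n + N) * norm v < min d1 d2"
        by (rule sequentially_offset)
      then show "\<forall>\<^sub>F n in sequentially. \<forall>s\<in>?S. \<forall>r.
          norm (r *\<^sub>R vector_derivative (q n) (at s) - r *\<^sub>R D x0 s (v, 0, z v s)) \<le> \<epsilon> * norm r"
      proof (eventually_elim, intro ballI allI)
        fix n s r assume small: "h (n + N) * norm v < min d1 d2" and s: "s \<in> ?S"
        have sT: "s \<in> {-T..T}" and sI: "s \<in> I" using s T by auto
        obtain q' where q': "(q n has_vector_derivative q') (at s)"
          "norm (q' - D x0 s (v, 0, q n s)) \<le> \<eta> * norm v"
          using d1(2)[OF h _ sT, of "n + N" v] small unfolding q_def by auto
        have "norm (D x0 s (v, 0, q n s) - D x0 s (v, 0, z v s)) \<le> L * norm (q n s - z v s)"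
          using frechet_derivative_state_bound[OF F x0 sI] by (simp add: variation_split[OF F x0 sI])
        also have "\<dots> \<le> L * (\<eta> * norm v)"
          using d2(2)[OF h _ sT, of "n + N" v] small L_nonneg unfolding q_def by (intro mult_left_mono) auto
        finally have "norm (q' - D x0 s (v, 0, z v s)) \<le> \<eta> * norm v + L * (\<eta> * norm v)"
          using q'(2) norm_triangle_ineq[of "q' - D x0 s (v, 0, q n s)" "D x0 s (v, 0, q n s) - D x0 s (v, 0, z v s)"]
          by simp
        also have "\<dots> \<le> \<epsilon>" using \<epsilon> by (simp add: algebra_simps)
        finally have "\<bar>r\<bar> * norm (q' - D x0 s (v, 0, z v s)) \<le> \<bar>r\<bar> * \<epsilon>"
          by (intro mult_left_mono) auto
        then show "norm (r *\<^sub>R vector_derivative (q n) (at s) - r *\<^sub>R D x0 s (v, 0, z v s)) \<le> \<epsilon> * norm r"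
          unfolding vector_derivative_at[OF q'(1)] scaleR_diff_right[symmetric] norm_scaleR by (simp add: mult.commute)
      qed
    qed simp
    then obtain g where g: "\<And>s. s \<in> ?S \<Longrightarrow> (\<lambda>n. q n s) \<longlonglongrightarrow> g s"
      "\<And>s. s \<in> ?S \<Longrightarrow> (g has_derivative (\<lambda>r. r *\<^sub>R D x0 s (v, 0, z v s))) (at s within ?S)"
      by blast
    have tS: "t \<in> ?S" using T by auto
    have "(g has_derivative (\<lambda>r. r *\<^sub>R D x0 t (v, 0, z v t))) (at t)"
      using g(2)[OF tS] tS by (simp add: at_within_open[OF tS])
    then have "(z v has_derivative (\<lambda>r. r *\<^sub>R D x0 t (v, 0, z v t))) (at t)"
      by (rule has_derivative_transform_within_open[OF _ _ tS]) (auto intro: LIMSEQ_unique[OF g(1) q_lim])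
    then show ?thesis by (simp add: has_vector_derivative_def)
  qed
  \<comment> \<open>The estimate is used on the degenerate interval \<open>T = 0\<close>; it
    identifies the initial value on which the uniqueness argument for linearity rests.\<close>
  have z0: "z v 0 = Y0 v" if e: "0 < e" for v
  proof (rule LIMSEQ_unique[OF lim tendstoI])
    show "0 \<in> I" using that by simp
    fix \<eta> :: real assume "\<eta> > 0"
    define \<eta>' where "\<eta>' = \<eta> / (1 + norm v)"
    have \<eta>': "\<eta>' > 0" using \<open>\<eta> > 0\<close> by (simp add: \<eta>'_def add_pos_nonneg)
    have \<eta>'v: "\<eta>' * norm v < \<eta>" using \<open>\<eta> > 0\<close> by (simp add: \<eta>'_def field_simps add_pos_nonneg)
    obtain d where d: "d > 0" "\<And>(v :: 'p) h t. 0 < h \<Longrightarrow> h * norm v < d \<Longrightarrow> t \<in> {-0..0} \<Longrightarrow>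
      \<exists>q'. (diff_quotient x0 v h has_vector_derivative q') (at t) \<and>
        norm (q' - D x0 t (v, 0, diff_quotient x0 v h t)) \<le> \<eta>' * norm v"
      "\<And>(v :: 'p) h. 0 < h \<Longrightarrow> h * norm v < d \<Longrightarrow>
        x0 + h *\<^sub>R v \<in> W \<and> norm (diff_quotient x0 v h 0 - Y0 v) \<le> \<eta>' * norm v"
      using diff_quotient_derivative[OF F y0 x0 order_refl e \<eta>'] by blast
    show "\<forall>\<^sub>F n in sequentially. dist (diff_quotient x0 v (h n) 0) (Y0 v) < \<eta>"
      using h_small[OF d(1), of "norm v"]
      by eventually_elim (use d(3)[OF h] \<eta>'v in \<open>force simp: dist_norm\<close>)
  qed
  \<comment> \<open>The defect \<open>?u\<close> solves the variational equation in direction 0 with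
    zero initial value, so Gronwall's inequality without error term makes it vanish.\<close>
  have comb: "z (r *\<^sub>R a + s *\<^sub>R b) t = r *\<^sub>R z a t + s *\<^sub>R z b t" if "t \<in> I" for a b r s t
  proof -
    let ?u = "\<lambda>t. z (r *\<^sub>R a + s *\<^sub>R b) t - (r *\<^sub>R z a t + s *\<^sub>R z b t)"
    let ?u' = "\<lambda>t. D x0 t (r *\<^sub>R a + s *\<^sub>R b, 0, z (r *\<^sub>R a + s *\<^sub>R b) t)
        - (r *\<^sub>R D x0 t (a, 0, z a t) + s *\<^sub>R D x0 t (b, 0, z b t))"
    have e: "0 < e" "\<bar>t\<bar> < e" using that by auto
    have seg: "\<tau> \<in> I" if "\<tau> \<in> closed_segment 0 t" for \<tau>
      using that e by (auto simp: closed_segment_eq_real_ivl split: if_splits)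
    have "norm (?u t) \<le> (norm (?u 0) + 0) * exp ((L + 1) * \<bar>t - 0\<bar>)"
    proof (rule norm_le_gronwall[OF L_nonneg order_refl])
      fix \<tau> assume "\<tau> \<in> closed_segment 0 t"
      then have \<tau>: "\<tau> \<in> I" by (rule seg)
      show "(?u has_vector_derivative ?u' \<tau>) (at \<tau>)"
        by (intro has_vector_derivative_diff has_vector_derivative_add ode \<tau>
            bounded_linear.has_vector_derivative[OF bounded_linear_scaleR_right])
      have "?u' \<tau> = D x0 \<tau> ((r *\<^sub>R a + s *\<^sub>R b, 0, z (r *\<^sub>R a + s *\<^sub>R b) \<tau>)
          - (r *\<^sub>R (a, 0, z a \<tau>) + s *\<^sub>R (b, 0, z b \<tau>)))"
        using frechet_derivative_linear[OF F x0 \<tau>] by (simp only: linear_diff linear_add linear_cmul)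
      then have "?u' \<tau> = D x0 \<tau> (0, 0, ?u \<tau>)"
        by simp
      then show "norm (?u' \<tau>) \<le> L * norm (?u \<tau>) + 0"
        using frechet_derivative_state_bound[OF F x0 \<tau>] by simp
    qed
    also have "?u 0 = 0"
      using linear_add[OF has_derivative_linear[OF y0]] linear_cmul[OF has_derivative_linear[OF y0]]
      by (simp add: z0[OF e(1)])
    finally show ?thesis by simp
  qed
  have "((\<lambda>x. y (x, t)) has_derivative (\<lambda>v. z v t)) (at x0)" if t: "t \<in> I" for t
    unfolding has_derivative_at_alt
  proof (intro conjI allI impI)
    have "linear (\<lambda>v. z v t)"
      using comb[OF t, of 1 _ 1] comb[OF t, of _ _ 0 0] by (intro linearI) auto
    then show "bounded_linear (\<lambda>v. z v t)" by (simp add: linear_conv_bounded_linear)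
    fix \<eta> :: real assume "\<eta> > 0"
    have tI: "0 \<le> \<bar>t\<bar>" "\<bar>t\<bar> < e" using t by auto
    obtain d where d: "d > 0" "\<And>(v :: 'p) k s. 0 < k \<Longrightarrow> k * norm v < d \<Longrightarrow> s \<in> {-\<bar>t\<bar>..\<bar>t\<bar>} \<Longrightarrow>
        norm (diff_quotient x0 v k s - z v s) \<le> \<eta> * norm v"
      using approx[OF tI \<open>\<eta> > 0\<close>] by blast
    show "\<exists>d>0. \<forall>x. norm (x - x0) < d \<longrightarrow> norm (y (x, t) - y (x0, t) - z (x - x0) t) \<le> \<eta> * norm (x - x0)"
    proof (intro exI[of _ d] conjI d(1) allI impI)
      \<comment> \<open>With step 1 and direction \<open>x - x0\<close> the quotient is the plain
        increment.\<close>
      fix x assume "norm (x - x0) < d"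
      then show "norm (y (x, t) - y (x0, t) - z (x - x0) t) \<le> \<eta> * norm (x - x0)"
        using d(2)[of 1 "x - x0" t] abs_ge_minus_self[of t] abs_ge_self[of t]
        by (simp add: diff_quotient_def)
    qed
  qed
  then show thesis
    using ode by (rule that)
qed

end

text \<open>For order \<open>k + 1\<close> the induction hypothesis is used twice. Applied to the
  equation itself it makes \<open>y\<close> of class \<open>C^k\<close>; this comes first, because
  the coefficients of the variational equation contain \<open>y\<close>. Applied to the variational
  equation it makes the parameter derivative \<open>C^k\<close>. The time derivative
  \<open>F (x, t, y (x, t))\<close> is \<open>C^k\<close> by composition.\<close>

theorem parametric_ode_Ck_on:
  assumes "parametric_ode W e V F L y" "Ck_on k (W \<times> {-e<..<e} \<times> V) F" "Ck_on k W (\<lambda>x. y (x, 0))"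
  shows "Ck_on k (W \<times> {-e<..<e}) y"
  using assms
proof (induction k arbitrary: V F y)
  case 0
  then show ?case
    using parametric_ode.continuous_solution[OF 0(1)] by simp
next
  case (Suc k)
  interpret parametric_ode W e V F L y by (rule Suc.prems(1))
  have F1: "Ck_on (Suc 0) (W \<times> I \<times> V) F"
    by (rule Ck_on_le[OF Suc.prems(2)]) simp
  have y: "Ck_on k (W \<times> I) y"
    using Suc.IH[OF Suc.prems(1)] Suc.prems(2,3)[THEN Ck_on_SucD] by blast
  define z where "z x v t = frechet_derivative (\<lambda>x. y (x, t)) (at x) v" for x v t
  have z: "((\<lambda>x. y (x, t)) has_derivative (\<lambda>v. z x v t)) (at x)"
    "(z x v has_vector_derivative D x t (v, 0, z x v t)) (at t)" if x: "x \<in> W" and t: "t \<in> I" for x v t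
  proof -
    obtain z' where z': "\<And>t. t \<in> I \<Longrightarrow> ((\<lambda>x. y (x, t)) has_derivative (\<lambda>v. z' v t)) (at x)"
      "\<And>v t. t \<in> I \<Longrightarrow> (z' v has_vector_derivative D x t (v, 0, z' v t)) (at t)"
      using variational_equation[OF F1 Ck_on_Suc_has_derivative[OF Suc.prems(3) x] x] by blast
    have eq: "z' v t = z x v t" if "t \<in> I" for v t
      unfolding z_def using fun_cong[OF frechet_derivative_at[OF z'(1)[OF that]]] by simp
    show "((\<lambda>x. y (x, t)) has_derivative (\<lambda>v. z x v t)) (at x)"
      using z'(1)[OF t] eq[OF t] by simp
    have "(z x v has_derivative (\<lambda>r. r *\<^sub>R D x t (v, 0, z' v t))) (at t)"
      using z'(2)[OF t] unfolding has_vector_derivative_def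
      by (rule has_derivative_transform_within_open[OF _ _ t]) (auto simp: eq)
    then show "(z x v has_vector_derivative D x t (v, 0, z x v t)) (at t)"
      by (simp add: has_vector_derivative_def eq[OF t])
  qed
  \<comment> \<open>The coefficients of the variational equation are derivatives of \<open>F\<close>
    along the graph of \<open>y\<close>, regarded as functions of parameter, time and the new state,
    and constant in the last.\<close>
  have graph: "Ck_on k (W \<times> I \<times> (UNIV :: 'b set)) (\<lambda>p. (fst p, fst (snd p), y (fst p, fst (snd p))))"
  proof -
    have o: "open (W \<times> I \<times> (UNIV :: 'b set))" by (intro open_Times open_W) auto
    have l: "bounded_linear (\<lambda>p::'a \<times> real \<times> 'b. (fst p, fst (snd p)))"
      by (intro bounded_linear_Pair bounded_linear_fst bounded_linear_compose[OF bounded_linear_fst bounded_linear_snd])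
    have yk: "Ck_on k (W \<times> I \<times> (UNIV :: 'b set)) (\<lambda>p. y (fst p, fst (snd p)))"
      by (rule Ck_on_compose[OF o _ y Ck_on_bounded_linear[OF l o]]) (auto intro: open_Times open_W)
    show ?thesis
      by (rule Ck_on_Pair[OF o _ Ck_on_Pair[OF o _ yk]])
        (intro o Ck_on_bounded_linear bounded_linear_fst bounded_linear_compose[OF bounded_linear_fst bounded_linear_snd])+
  qed
  \<comment> \<open>The variational equation is linear, so the induction hypothesis applies to it on the whole state
    space, with the Lipschitz constant of \<open>F\<close>.\<close>
  have zk: "Ck_on k (W \<times> I) (\<lambda>(x, t). z x v t)" for v
  proof (rule Suc.IH)
    let ?G = "\<lambda>(x, t, u). D x t (v, 0, u)"
    show "parametric_ode W e UNIV ?G L (\<lambda>(x, t). z x v t)"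
    proof
      fix x t u w assume x: "x \<in> W" and t: "t \<in> I"
      show "norm (?G (x, t, u) - ?G (x, t, w)) \<le> L * norm (u - w)"
        using frechet_derivative_state_bound[OF F1 x t] by (simp add: variation_split[OF F1 x t])
      show "((\<lambda>t. (\<lambda>(x, t). z x v t) (x, t)) has_vector_derivative ?G (x, t, (\<lambda>(x, t). z x v t) (x, t))) (at t)"
        using z(2)[OF x t] by simp
    qed (use open_W L_nonneg in auto)
    have o: "open (W \<times> I \<times> (UNIV :: 'b set))" by (intro open_Times open_W) auto
    have "Ck_on k (W \<times> I \<times> UNIV) (\<lambda>p. D (fst p) (fst (snd p)) (v, 0, snd (snd p)))"
    proof (rule Ck_on_linear_apply[where A = "\<lambda>p. D (fst p) (fst (snd p))"
          and f = "\<lambda>p. (v, 0, snd (snd p))", OF o])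
      show "linear (D (fst p) (fst (snd p)))" if "p \<in> W \<times> I \<times> UNIV" for p :: "'a \<times> real \<times> 'b"
        using that by (intro frechet_derivative_linear[OF F1]) auto
      show "Ck_on k (W \<times> I \<times> (UNIV :: 'b set)) (\<lambda>p. D (fst p) (fst (snd p)) w)" for w
        by (rule Ck_on_compose[OF o open_domain Ck_on_Suc_frechet_derivative[OF Suc.prems(2)] graph])
          (auto intro: solution_in)
      show "Ck_on k (W \<times> I \<times> (UNIV :: 'b set)) (\<lambda>p. (v, 0 :: real, snd (snd p)))"
        by (intro Ck_on_Pair o Ck_on_const Ck_on_bounded_linear bounded_linear_compose[OF bounded_linear_snd bounded_linear_snd])
    qed
    then show "Ck_on k (W \<times> I \<times> UNIV) ?G"
      by (simp add: case_prod_beta')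
    show "Ck_on k W (\<lambda>x. (\<lambda>(x, t). z x v t) (x, 0))"
      using Ck_on_Suc_frechet_derivative[OF Suc.prems(3)] by (simp add: z_def)
  qed
  let ?F = "\<lambda>p. F (fst p, snd p, y (fst p, snd p))"
  have o: "open (W \<times> I)" by (intro open_Times open_W) auto
  have Fk: "Ck_on k (W \<times> I) ?F"
  proof (rule Ck_on_compose[OF o open_domain Ck_on_SucD[OF Suc.prems(2)]])
    have yk: "Ck_on k (W \<times> I) (\<lambda>p. y (fst p, snd p))" using y by simp
    show "Ck_on k (W \<times> I) (\<lambda>p. (fst p, snd p, y (fst p, snd p)))"
      by (rule Ck_on_Pair[OF o _ Ck_on_Pair[OF o _ yk]])
        (intro o Ck_on_bounded_linear bounded_linear_fst bounded_linear_snd)+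
  qed (auto intro: solution_in)
  show ?case
  proof (rule Ck_on_SucI[OF o])
    fix p assume p: "p \<in> W \<times> I"
    then obtain x t where xt: "p = (x, t)" "x \<in> W" "t \<in> I" by auto
    \<comment> \<open>The criterion for joint differentiability takes the parameter derivative at
      the point alone, but the time derivative nearby and continuous as an operator, hence its form
      as a bounded linear function.\<close>
    have "((\<lambda>(x, t). y (x, t)) has_derivative
        (\<lambda>(a, s). z x a t + blinfun_apply (blinfun_scaleR_left (?F (x, t))) s)) (at (x, t) within W \<times> I)"
    proof (rule has_derivative_partialsI)
      show "((\<lambda>x. y (x, t)) has_derivative (\<lambda>a. z x a t)) (at x within W)"
        by (rule has_derivative_at_withinI[OF z(1)[OF xt(2,3)]])
      show "((\<lambda>t. y (x, t)) has_derivative blinfun_apply (blinfun_scaleR_left (?F (x, t)))) (at t within I)"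
        if "x \<in> W" "t \<in> I" for x t
        using solution_derivative[OF that]
        by (auto simp: has_vector_derivative_def intro: has_derivative_at_withinI)
      have "continuous_on (W \<times> I) (\<lambda>p. blinfun_scaleR_left (?F p))"
        by (intro bounded_linear.continuous_on[OF bounded_linear_blinfun_scaleR_left] Ck_on_imp_continuous_on[OF Fk])
      then show "continuous (at (x, t) within W \<times> I) (\<lambda>(x, t). blinfun_scaleR_left (?F (x, t)))"
        using p xt by (simp add: continuous_on_eq_continuous_within case_prod_beta')
    qed (use xt in auto)
    then show "(y has_derivative (\<lambda>v. z (fst p) (fst v) (snd p) + snd v *\<^sub>R ?F p)) (at p)"
      using p by (simp add: at_within_open[OF _ o] xt case_prod_beta')
  next
    fix v :: "'a \<times> real"
    show "Ck_on k (W \<times> I) (\<lambda>p. z (fst p) (fst v) (snd p) + snd v *\<^sub>R ?F p)"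
      using zk[of "fst v"] by (intro Ck_on_add o Ck_on_bounded_linear_compose[OF bounded_linear_scaleR_right o Fk])
        (simp add: case_prod_beta')
  qed
qed

corollary parametric_ode_smooth_on:
  assumes "parametric_ode W e V F L y" "smooth_on (W \<times> {-e<..<e} \<times> V) F" "smooth_on W (\<lambda>x. y (x, 0))"
  shows "smooth_on (W \<times> {-e<..<e}) y"
  using assms parametric_ode_Ck_on[OF assms(1)] unfolding smooth_on_def by blast

section \<open>Smooth maps between manifolds\<close>

lemma smooth_on_locally:
  assumes "\<And>x. x \<in> S \<Longrightarrow> \<exists>T. open T \<and> x \<in> T \<and> smooth_on T f"
  shows "smooth_on S f"
proof (rule smooth_on_subset)
  show "smooth_on (\<Union>{T. open T \<and> smooth_on T f}) f"
    by (rule smooth_on_UnionI) auto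
qed (use assms in blast)

lemma smooth_manifold_chart:
  assumes "smooth_manifold A" "c \<in> A"
  shows open_chart_domain: "open (fst c)"
    and open_chart_image: "open (snd c ` fst c)"
    and chart_inv_left: "p \<in> fst c \<Longrightarrow> chart_inv c (snd c p) = p"
    and chart_inv_right: "x \<in> snd c ` fst c \<Longrightarrow> snd c (chart_inv c x) = x"
    and chart_inv_in: "x \<in> snd c ` fst c \<Longrightarrow> chart_inv c x \<in> fst c"
    and continuous_on_chart: "continuous_on (fst c) (snd c)"
    and continuous_on_chart_inv: "continuous_on (snd c ` fst c) (chart_inv c)"
proof -
  have o: "open (fst c)" "open (snd c ` fst c)" and h: "homeomorphism (fst c) (snd c ` fst c) (snd c) (chart_inv c)"
    using assms unfolding smooth_manifold_def by blast+
  show "open (fst c)" "open (snd c ` fst c)" by fact+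
  show "p \<in> fst c \<Longrightarrow> chart_inv c (snd c p) = p" "x \<in> snd c ` fst c \<Longrightarrow> snd c (chart_inv c x) = x"
    "x \<in> snd c ` fst c \<Longrightarrow> chart_inv c x \<in> fst c"
    "continuous_on (fst c) (snd c)" "continuous_on (snd c ` fst c) (chart_inv c)"
    using h unfolding homeomorphism_def by auto
qed

lemma open_chart_preimage:
  assumes "smooth_manifold A" "c \<in> A" "open T"
  shows "open (fst c \<inter> snd c -` T)"
  by (intro continuous_open_preimage smooth_manifold_chart[OF assms(1,2)] assms)

lemma open_chart_image_open:
  assumes "smooth_manifold A" "c \<in> A" "open N" "N \<subseteq> fst c"
  shows "open (snd c ` N)"
proof -
  have "snd c ` N = snd c ` fst c \<inter> chart_inv c -` N"
    using assms(4) by (auto simp: smooth_manifold_chart[OF assms(1,2)] image_iff)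
  then show ?thesis
    by (simp add: continuous_open_preimage smooth_manifold_chart[OF assms(1,2)] assms(3))
qed

lemma chart_around:
  assumes "smooth_manifold A"
  obtains c where "c \<in> A" "p \<in> fst c"
  using assms unfolding smooth_manifold_def carrier_of_def by blast

lemma smooth_transition:
  assumes "smooth_manifold A" "c \<in> A" "d \<in> A"
  shows "smooth_on (snd c ` (fst c \<inter> fst d)) (\<lambda>x. snd d (chart_inv c x))"
  using assms unfolding smooth_manifold_def o_def by blast

text \<open>Asking for one suitable pair of charts makes this easy to establish; that every pair
  around the two points works is proved below. Requiring \<open>N\<close> to be mapped into the
  domain of \<open>d\<close> builds in continuity.\<close>

definition smooth_near ::
    "('a::topological_space, 'd::euclidean_space) atlas \<Rightarrow> ('b, 'e::euclidean_space) atlas \<Rightarrow> ('a \<Rightarrow> 'b) \<Rightarrow> 'a \<Rightarrow> bool" where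
  "smooth_near A B F p \<longleftrightarrow> (\<exists>c\<in>A. \<exists>d\<in>B. \<exists>N. open N \<and> p \<in> N \<and> N \<subseteq> fst c \<and> F ` N \<subseteq> fst d \<and>
     smooth_on (snd c ` N) (\<lambda>x. snd d (F (chart_inv c x))))"

lemma smooth_nearI:
  assumes A: "smooth_manifold A" and c: "c \<in> A" and "d \<in> B" and N: "open N" "p \<in> N" "N \<subseteq> fst c"
    and "F ` N \<subseteq> fst d" "smooth_on (snd c ` N) r" "\<And>q. q \<in> N \<Longrightarrow> snd d (F q) = r (snd c q)"
  shows "smooth_near A B F p"
proof -
  have "smooth_on (snd c ` N) (\<lambda>x. snd d (F (chart_inv c x)))"
    by (rule smooth_on_cong[OF open_chart_image_open[OF A c N(1,3)] assms(8)])
      (use N(3) assms(9) in \<open>auto simp: chart_inv_left[OF A c] subset_iff\<close>)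
  with assms show ?thesis
    unfolding smooth_near_def by blast
qed

text \<open>On \<open>N\<close> the map is recovered from its coordinate representative by composing
  with a chart and an inverse chart, both continuous.\<close>

lemma smooth_near_continuous:
  assumes A: "smooth_manifold A" and B: "smooth_manifold B" and "smooth_near A B F p"
  obtains N where "open N" "p \<in> N" "continuous_on N F"
proof -
  obtain c d N where c: "c \<in> A" and d: "d \<in> B" and N: "open N" "p \<in> N" "N \<subseteq> fst c" "F ` N \<subseteq> fst d"
    and sm: "smooth_on (snd c ` N) (\<lambda>x. snd d (F (chart_inv c x)))"
    using assms(3) unfolding smooth_near_def by blast
  have "continuous_on N (\<lambda>q. chart_inv d (snd d (F (chart_inv c (snd c q)))))"
  proof (rule continuous_on_compose2[OF continuous_on_chart_inv[OF B d]])
    show "continuous_on N (\<lambda>q. snd d (F (chart_inv c (snd c q))))"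
      by (rule continuous_on_compose2[OF smooth_on_imp_continuous_on[OF sm]
            continuous_on_subset[OF continuous_on_chart[OF A c] N(3)]]) auto
    show "(\<lambda>q. snd d (F (chart_inv c (snd c q)))) ` N \<subseteq> snd d ` fst d"
      using N by (auto simp: chart_inv_left[OF A c] subset_iff)
  qed
  then have "continuous_on N F"
    using N by (auto simp: chart_inv_left[OF A c] chart_inv_left[OF B d] subset_iff image_subset_iff cong: continuous_on_cong)
  with N show thesis by (auto intro: that)
qed

text \<open>In the new charts the representative is the old one between two transition maps;
  continuity of \<open>F\<close> provides a neighbourhood mapped into the domain of
  \<open>d\<close>.\<close>

lemma smooth_near_charts:
  assumes A: "smooth_manifold A" and B: "smooth_manifold B" and "smooth_near A B F p"
    and c: "c \<in> A" "p \<in> fst c" and d: "d \<in> B" "F p \<in> fst d"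
  obtains N where "open N" "p \<in> N" "N \<subseteq> fst c" "F ` N \<subseteq> fst d"
    "smooth_on (snd c ` N) (\<lambda>x. snd d (F (chart_inv c x)))"
proof -
  obtain c0 d0 N0 where c0: "c0 \<in> A" and d0: "d0 \<in> B" and N0: "open N0" "p \<in> N0" "N0 \<subseteq> fst c0" "F ` N0 \<subseteq> fst d0"
    and sm: "smooth_on (snd c0 ` N0) (\<lambda>x. snd d0 (F (chart_inv c0 x)))"
    using assms(3) unfolding smooth_near_def by blast
  obtain N1 where N1: "open N1" "p \<in> N1" "continuous_on N1 F"
    by (rule smooth_near_continuous[OF assms(1-3)])
  define N where "N = (N1 \<inter> F -` fst d) \<inter> (N0 \<inter> fst c)"
  have N: "open N" "p \<in> N" "N \<subseteq> fst c" "F ` N \<subseteq> fst d" "N \<subseteq> N0"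
    unfolding N_def using N0 N1 c d continuous_open_preimage[OF N1(3,1) open_chart_domain[OF B d(1)]]
    by (auto intro!: open_Int[of "_ \<inter> _" "_ \<inter> _"] open_Int[of N0] open_chart_domain[OF A c(1)])
  have oN: "open (snd c ` N)" and oN0: "open (snd c0 ` N0)"
    using open_chart_image_open[OF A] c c0 N N0 by blast+
  have "smooth_on (snd c ` N) (\<lambda>x. snd c0 (chart_inv c x))"
    by (intro smooth_on_subset[OF smooth_transition[OF A c(1) c0]] image_mono) (use N N0 in blast)
  then have "smooth_on (snd c ` N) (\<lambda>x. snd d0 (F (chart_inv c0 (snd c0 (chart_inv c x)))))"
    by (rule smooth_on_compose[OF oN oN0 sm]) (use N in \<open>auto simp: chart_inv_left[OF A c(1)] subset_iff\<close>)
  moreover have "open (snd d0 ` (fst d0 \<inter> fst d))"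
    by (intro open_chart_image_open[OF B d0] open_Int open_chart_domain[OF B] d0 d(1)) auto
  ultimately have "smooth_on (snd c ` N) (\<lambda>x. snd d (chart_inv d0 (snd d0 (F (chart_inv c0 (snd c0 (chart_inv c x)))))))"
    by (intro smooth_on_compose[OF oN _ smooth_transition[OF B d0 d(1)]])
      (use N N0 in \<open>auto simp: chart_inv_left[OF A c(1)] chart_inv_left[OF A c0] subset_iff image_subset_iff\<close>)
  then have "smooth_on (snd c ` N) (\<lambda>x. snd d (F (chart_inv c x)))"
    by (rule smooth_on_cong[OF oN])
      (use N N0 in \<open>auto simp: chart_inv_left[OF A c(1)] chart_inv_left[OF A c0] chart_inv_left[OF B d0]
        subset_iff image_subset_iff\<close>)
  with N show thesis by (auto intro: that)
qed

lemma smooth_near_compose: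
  assumes A: "smooth_manifold A" and B: "smooth_manifold B" and C: "smooth_manifold C"
    and F: "smooth_near A B F p" and G: "smooth_near B C G (F p)"
  shows "smooth_near A C (\<lambda>p. G (F p)) p"
proof -
  obtain c where c: "c \<in> A" "p \<in> fst c" using chart_around[OF A] .
  obtain d where d: "d \<in> B" "F p \<in> fst d" using chart_around[OF B] .
  obtain e where e: "e \<in> C" "G (F p) \<in> fst e" using chart_around[OF C] .
  obtain N where N: "open N" "p \<in> N" "N \<subseteq> fst c" "F ` N \<subseteq> fst d"
    "smooth_on (snd c ` N) (\<lambda>x. snd d (F (chart_inv c x)))"
    by (rule smooth_near_charts[OF A B F c d])
  obtain N' where N': "open N'" "F p \<in> N'" "N' \<subseteq> fst d" "G ` N' \<subseteq> fst e"
    "smooth_on (snd d ` N') (\<lambda>x. snd e (G (chart_inv d x)))"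
    by (rule smooth_near_charts[OF B C G d e])
  obtain N1 where N1: "open N1" "p \<in> N1" "continuous_on N1 F"
    by (rule smooth_near_continuous[OF A B F])
  define S where "S = (N1 \<inter> F -` N') \<inter> N"
  have S: "open S" "p \<in> S" "S \<subseteq> fst c" "F ` S \<subseteq> N'" "S \<subseteq> N"
    unfolding S_def using N N1 N' open_Int[OF continuous_open_preimage[OF N1(3,1) N'(1)] N(1)] by auto
  have oS: "open (snd c ` S)" by (rule open_chart_image_open[OF A c(1) S(1,3)])
  have "smooth_on (snd c ` S) (\<lambda>x. snd e (G (chart_inv d (snd d (F (chart_inv c x))))))"
    by (rule smooth_on_compose[OF oS open_chart_image_open[OF B d(1) N'(1,3)] N'(5) smooth_on_subset[OF N(5)]])
      (use S in \<open>auto simp: chart_inv_left[OF A c(1)] subset_iff image_subset_iff\<close>)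
  then show ?thesis
    by (intro smooth_nearI[OF A c(1) e(1) S(1-3)])
      (use S N N' in \<open>auto simp: chart_inv_left[OF A c(1)] chart_inv_left[OF B d(1)] subset_iff image_subset_iff\<close>)
qed

lemma smooth_near_isCont:
  assumes "smooth_manifold A" "smooth_manifold B" "smooth_near A B F p"
  shows "isCont F p"
  using smooth_near_continuous[OF assms] by (metis continuous_on_eq_continuous_at)

text \<open>Bridges the definition, which speaks of all pairs of charts on their full overlaps, and
  the pointwise notion, which composes well.\<close>

lemma smooth_map_iff:
  assumes A: "smooth_manifold A" and B: "smooth_manifold B"
  shows "smooth_map A B F \<longleftrightarrow> (\<forall>p. smooth_near A B F p)"
proof (intro iffI allI)
  fix p assume F: "smooth_map A B F"
  obtain c where c: "c \<in> A" "p \<in> fst c" using chart_around[OF A] .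
  obtain d where d: "d \<in> B" "F p \<in> fst d" using chart_around[OF B] .
  let ?N = "fst c \<inter> F -` fst d"
  have o: "open (snd c ` ?N)" and sm: "smooth_on (snd c ` ?N) (\<lambda>x. snd d (F (chart_inv c x)))"
    using F c d unfolding smooth_map_def o_def by blast+
  \<comment> \<open>Openness is known for the coordinate image; injectivity of the chart on its
    domain pulls it back to the manifold.\<close>
  have "?N = fst c \<inter> snd c -` (snd c ` ?N)"
    using chart_inv_left[OF A c(1)] by auto (metis vimage_eq)
  then have "open ?N"
    using open_chart_preimage[OF A c(1) o] by simp
  with sm c d show "smooth_near A B F p"
    by (intro smooth_nearI[OF A c(1) d(1), of ?N]) (auto simp: chart_inv_left[OF A c(1)])
next
  assume F: "\<forall>p. smooth_near A B F p"
  have cont: "continuous_on UNIV F"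
    using F by (auto intro!: continuous_at_imp_continuous_on smooth_near_isCont[OF A B])
  have "open (snd c ` (fst c \<inter> F -` fst d)) \<and>
      smooth_on (snd c ` (fst c \<inter> F -` fst d)) (\<lambda>x. snd d (F (chart_inv c x)))" if c: "c \<in> A" and d: "d \<in> B" for c d
  proof
    have "open (F -` fst d)"
      using cont open_chart_domain[OF B d] by (simp add: continuous_on_open_vimage)
    then show "open (snd c ` (fst c \<inter> F -` fst d))"
      by (intro open_chart_image_open[OF A c] open_Int open_chart_domain[OF A c]) auto
    show "smooth_on (snd c ` (fst c \<inter> F -` fst d)) (\<lambda>x. snd d (F (chart_inv c x)))"
    proof (rule smooth_on_locally)
      fix x assume "x \<in> snd c ` (fst c \<inter> F -` fst d)"
      then obtain p where p: "x = snd c p" "p \<in> fst c" "F p \<in> fst d" by auto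
      obtain N where N: "open N" "p \<in> N" "N \<subseteq> fst c" "F ` N \<subseteq> fst d"
        "smooth_on (snd c ` N) (\<lambda>x. snd d (F (chart_inv c x)))"
        by (rule smooth_near_charts[OF A B F[rule_format] c p(2) d p(3)])
      then show "\<exists>T. open T \<and> x \<in> T \<and> smooth_on T (\<lambda>x. snd d (F (chart_inv c x)))"
        using p open_chart_image_open[OF A c N(1,3)] by blast
    qed
  qed
  moreover have "carrier_of B = UNIV"
    using B by (simp add: smooth_manifold_def)
  ultimately show "smooth_map A B F"
    unfolding smooth_map_def o_def by auto
qed

lemma smooth_map_continuous_on:
  assumes "smooth_manifold A" "smooth_manifold B" "smooth_map A B F"
  shows "continuous_on UNIV F"
  using assms by (auto intro!: continuous_at_imp_continuous_on smooth_near_isCont simp: smooth_map_iff)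

section \<open>The product with the real line\<close>

lemma times_real_eq: "times_real A = (\<lambda>c. (fst c \<times> UNIV, \<lambda>(p, t). (snd c p, t))) ` A"
  by (simp add: times_real_def case_prod_beta')

text \<open>\<open>chart_inv\<close> is an \<open>inv_into\<close>, hence meaningful only on the
  image of the chart; this explains the condition on \<open>x\<close>.\<close>

lemma chart_inv_times_real:
  assumes "smooth_manifold A" "c \<in> A" "x \<in> snd c ` fst c"
  shows "chart_inv (fst c \<times> UNIV, \<lambda>(p, t). (snd c p, t)) (x, t :: real) = (chart_inv c x, t)"
  unfolding chart_inv_def[of "(_, _)"] fst_conv snd_conv
proof (rule inv_into_f_eq)
  show "inj_on (\<lambda>(p, t). (snd c p, t)) (fst c \<times> (UNIV :: real set))"
    using chart_inv_left[OF assms(1,2)] by (auto simp: inj_on_def) metis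
qed (use smooth_manifold_chart[OF assms(1,2)] assms(3) in auto)

lemma smooth_manifold_times_real:
  assumes A: "smooth_manifold A"
  shows "smooth_manifold (times_real A)"
  unfolding smooth_manifold_def
proof (intro conjI ballI)
  show "carrier_of (times_real A) = UNIV"
    using A unfolding smooth_manifold_def carrier_of_def times_real_eq by (auto simp: set_eq_iff)
next
  fix c' assume "c' \<in> times_real A"
  then obtain c where c: "c \<in> A" "c' = (fst c \<times> UNIV, \<lambda>(p, t). (snd c p, t))"
    by (auto simp: times_real_eq)
  have img: "snd c' ` fst c' = (snd c ` fst c) \<times> UNIV"
    by (auto simp: c(2) image_iff)
  show "open (fst c')" "open (snd c' ` fst c')"
    unfolding img by (auto simp: c(2) intro!: open_Times smooth_manifold_chart[OF A c(1)])
  have inv: "chart_inv c' (x, t) = (chart_inv c x, t)" if "x \<in> snd c ` fst c" for x t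
    unfolding c(2) by (rule chart_inv_times_real[OF A c(1) that])
  show "homeomorphism (fst c') (snd c' ` fst c') (snd c') (chart_inv c')"
  proof
    show "continuous_on (fst c') (snd c')"
      unfolding c(2) fst_conv snd_conv case_prod_beta'
      by (intro continuous_on_Pair continuous_on_compose2[OF continuous_on_chart[OF A c(1)]] continuous_intros) auto
    have "continuous_on (snd c ` fst c \<times> UNIV) (\<lambda>q::'b \<times> real. (chart_inv c (fst q), snd q))"
      by (intro continuous_on_Pair continuous_on_compose2[OF continuous_on_chart_inv[OF A c(1)]] continuous_intros) auto
    then show "continuous_on (snd c' ` fst c') (chart_inv c')"
      unfolding img by (rule continuous_on_eq) (auto simp: inv)
    show "chart_inv c' ` (snd c' ` fst c') \<subseteq> fst c'"
      unfolding img using inv by (auto simp: chart_inv_left[OF A c(1)]) (simp add: c(2))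
    show "chart_inv c' (snd c' q) = q" if "q \<in> fst c'" for q
      using that inv by (auto simp: c(2) chart_inv_left[OF A c(1)])
    show "snd c' (chart_inv c' q) = q" if "q \<in> snd c' ` fst c'" for q
      using that unfolding img by (auto simp: inv chart_inv_left[OF A c(1)]) (simp add: c(2))
  qed auto
  fix d' assume "d' \<in> times_real A"
  then obtain d where d: "d \<in> A" "d' = (fst d \<times> UNIV, \<lambda>(p, t). (snd d p, t))"
    by (auto simp: times_real_eq)
  let ?S = "snd c ` (fst c \<inter> fst d)"
  have oS: "open ?S"
    by (intro open_chart_image_open[OF A c(1)] open_Int open_chart_domain[OF A] c d) auto
  have o: "open (?S \<times> (UNIV :: real set))"
    by (intro open_Times oS) auto
  have "smooth_on (?S \<times> UNIV) (\<lambda>q::'b \<times> real. (snd d (chart_inv c (fst q)), snd q))"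
    by (intro smooth_on_Pair o smooth_on_compose[OF o oS smooth_transition[OF A c(1) d(1)]]
        smooth_on_bounded_linear bounded_linear_fst bounded_linear_snd) auto
  then have "smooth_on (?S \<times> UNIV) (snd d' \<circ> chart_inv c')"
    by (rule smooth_on_cong[OF o]) (auto simp: inv d(2))
  moreover have "snd c' ` (fst c' \<inter> fst d') = ?S \<times> UNIV"
    by (auto simp: c(2) d(2) image_iff)
  ultimately show "smooth_on (snd c' ` (fst c' \<inter> fst d')) (snd d' \<circ> chart_inv c')"
    by simp
qed

section \<open>Flows\<close>

text \<open>Provides both constants of the local theory: \<open>K\<close> limits how fast a curve
  can leave the ball, and \<open>L\<close> is the Lipschitz constant of the equation. Convexity of
  the ball turns the derivative bound into the latter.\<close>

lemma smooth_on_locally_bounded_Lipschitz: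
  fixes f :: "'a::euclidean_space \<Rightarrow> 'b::euclidean_space"
  assumes "open S" "smooth_on S f" "x0 \<in> S"
  obtains r K L where "r > 0" "K > 0" "L \<ge> 0" "cball x0 r \<subseteq> S"
    "\<And>x. x \<in> cball x0 r \<Longrightarrow> norm (f x) \<le> K"
    "\<And>x y. x \<in> cball x0 r \<Longrightarrow> y \<in> cball x0 r \<Longrightarrow> norm (f x - f y) \<le> L * norm (x - y)"
proof -
  let ?D = "\<lambda>x. frechet_derivative f (at x)"
  obtain r where r: "r > 0" "cball x0 r \<subseteq> S"
    using assms(1,3) open_contains_cball by blast
  have "bounded (f ` cball x0 r)"
    using smooth_on_imp_continuous_on[OF assms(2)] r(2)
    by (intro compact_imp_bounded compact_continuous_image compact_cball) (rule continuous_on_subset)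
  then obtain K where K: "K > 0" "\<forall>x\<in>cball x0 r. norm (f x) \<le> K"
    unfolding bounded_pos by auto
  have "continuous_on (cball x0 r) (\<lambda>x. \<Sum>i\<in>Basis. norm (?D x i))"
    by (intro continuous_intros continuous_on_subset[OF _ r(2)] smooth_on_imp_continuous_on
        smooth_on_frechet_derivative assms(2))
  then have "bounded ((\<lambda>x. \<Sum>i\<in>Basis. norm (?D x i)) ` cball x0 r)"
    by (intro compact_imp_bounded compact_continuous_image compact_cball)
  then obtain L where L: "L > 0" "\<forall>x\<in>cball x0 r. (\<Sum>i\<in>Basis. norm (?D x i)) \<le> L"
    unfolding bounded_pos by (auto simp: sum_nonneg)
  have der: "(f has_derivative ?D x) (at x)" if "x \<in> cball x0 r" for x
    using that r(2) by (intro smooth_on_has_derivative[OF assms(2)]) auto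
  have "onorm (?D x) \<le> L" if x: "x \<in> cball x0 r" for x
  proof (rule onorm_le)
    fix v
    have "?D x v = (\<Sum>i\<in>Basis. (v \<bullet> i) *\<^sub>R ?D x i)"
      by (rule linear_eq_sum_Basis[OF has_derivative_linear[OF der[OF x]]])
    also have "norm \<dots> \<le> (\<Sum>i\<in>Basis. norm v * norm (?D x i))"
      by (intro sum_norm_le) (simp add: Basis_le_norm mult_right_mono)
    also have "\<dots> \<le> norm v * L"
      unfolding sum_distrib_left[symmetric] using L x by (intro mult_left_mono) auto
    finally show "norm (?D x v) \<le> L * norm v" by (simp add: mult.commute)
  qed
  then have "norm (f x - f y) \<le> L * norm (x - y)" if "x \<in> cball x0 r" "y \<in> cball x0 r" for x y
    using that by (intro differentiable_bound[OF convex_cball has_derivative_at_withinI[OF der]])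
  then show thesis
    using r K L by (intro that[of r K L]) auto
qed

lemma smooth_near_slice:
  assumes A: "smooth_manifold A"
  shows "smooth_near A (times_real A) (\<lambda>p. (p, s)) p"
proof -
  obtain c where c: "c \<in> A" "p \<in> fst c" using chart_around[OF A] .
  have o: "open (snd c ` fst c)" by (rule open_chart_image[OF A c(1)])
  show ?thesis
    by (rule smooth_nearI[OF A c(1) _ open_chart_domain[OF A c(1)] c(2), of "(fst c \<times> UNIV, \<lambda>(p, t). (snd c p, t))"
          _ _ "\<lambda>x. (x, s)"])
      (use c in \<open>auto simp: times_real_eq intro!: smooth_on_Pair o smooth_on_ident smooth_on_const\<close>)
qed

text \<open>Used with \<open>a = 1\<close> to translate time and with \<open>b = 0\<close> to
  rescale it, which turns a flow into an isotopy.\<close>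

lemma smooth_near_affine_time:
  assumes A: "smooth_manifold A"
  shows "smooth_near (times_real A) (times_real A) (\<lambda>(p, t). (p, a * t + b)) q"
proof -
  obtain c where c: "c \<in> A" "fst q \<in> fst c" using chart_around[OF A] .
  let ?c = "(fst c \<times> UNIV, \<lambda>(p, t). (snd c p, t)) :: ('a \<times> real, 'b \<times> real) chart"
  have tc: "?c \<in> times_real A" using c by (auto simp: times_real_eq)
  note T = smooth_manifold_times_real[OF A]
  have o: "open (snd ?c ` fst ?c)" by (rule open_chart_image[OF T tc])
  have "smooth_on (snd ?c ` fst ?c) (\<lambda>x. (0, b) + (fst x, a * snd x))"
    unfolding smooth_on_def
    by (intro allI Ck_on_add o Ck_on_const Ck_on_bounded_linear bounded_linear_Pair bounded_linear_fst
        bounded_linear_const_mult bounded_linear_snd)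
  then show ?thesis
    by (intro smooth_nearI[OF T tc tc open_chart_domain[OF T tc]]) (use c in \<open>auto simp: mem_Times_iff\<close>)
qed

section \<open>Integral curves and their uniqueness\<close>

lemma integral_curve_iff:
  "integral_curve M \<xi> \<gamma> \<longleftrightarrow> (\<forall>t. isCont \<gamma> t \<and> fst (\<xi> (\<gamma> t)) = \<gamma> t \<and>
    (\<forall>c\<in>M. \<gamma> t \<in> fst c \<longrightarrow> ((snd c \<circ> \<gamma>) has_vector_derivative snd (\<xi> (\<gamma> t)) c) (at t)) \<and>
    (\<forall>c. c \<notin> M \<or> \<gamma> t \<notin> fst c \<longrightarrow> snd (\<xi> (\<gamma> t)) c = 0))"
proof -
  have has_vd: "(f has_vector_derivative v) (at t) \<longleftrightarrow> f differentiable (at t) \<and> vector_derivative f (at t) = v"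
    for f :: "real \<Rightarrow> 'b" and v t
    by (metis differentiableI_vector vector_derivative_at vector_derivative_works)
  have "differentiable_curve_at M \<gamma> t \<and> velocity M \<gamma> t = \<xi> (\<gamma> t) \<longleftrightarrow>
    isCont \<gamma> t \<and> fst (\<xi> (\<gamma> t)) = \<gamma> t \<and>
    (\<forall>c\<in>M. \<gamma> t \<in> fst c \<longrightarrow> ((snd c \<circ> \<gamma>) has_vector_derivative snd (\<xi> (\<gamma> t)) c) (at t)) \<and>
    (\<forall>c. c \<notin> M \<or> \<gamma> t \<notin> fst c \<longrightarrow> snd (\<xi> (\<gamma> t)) c = 0)" for t
    unfolding differentiable_curve_at_def velocity_def prod_eq_iff fst_conv snd_conv fun_eq_iff has_vd
    by (smt (verit, best))
  then show ?thesis
    unfolding integral_curve_def by blast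
qed

lemma has_vector_derivative_shift:
  assumes "(f has_vector_derivative v) (at (s + t))"
  shows "((\<lambda>t. f (s + t)) has_vector_derivative v) (at t)"
proof -
  have "((\<lambda>t. s + t) has_vector_derivative 1) (at t)"
    by (auto intro!: derivative_eq_intros)
  from vector_diff_chain_at[OF this assms] show ?thesis by (simp add: o_def)
qed

lemma integral_curve_shift:
  assumes "integral_curve M \<xi> \<gamma>"
  shows "integral_curve M \<xi> (\<lambda>t. \<gamma> (s + t))"
proof -
  have *: "isCont \<gamma> (s + t)" "fst (\<xi> (\<gamma> (s + t))) = \<gamma> (s + t)"
    "\<And>c. c \<in> M \<Longrightarrow> \<gamma> (s + t) \<in> fst c \<Longrightarrow> ((\<lambda>t. snd c (\<gamma> t)) has_vector_derivative snd (\<xi> (\<gamma> (s + t))) c) (at (s + t))"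
    "\<And>c. c \<notin> M \<or> \<gamma> (s + t) \<notin> fst c \<Longrightarrow> snd (\<xi> (\<gamma> (s + t))) c = 0" for t
    using assms unfolding integral_curve_iff o_def by blast+
  have "isCont (\<lambda>t. \<gamma> (s + t)) t" for t
    by (rule isCont_o2[where f = "\<lambda>t. s + t" and g = \<gamma>, OF _ *(1)]) simp
  with *(2,4) show ?thesis
    unfolding integral_curve_iff o_def using has_vector_derivative_shift[OF *(3)] by blast
qed

definition vf_coord where "vf_coord \<xi> c x = snd (\<xi> (chart_inv c x)) c"

text \<open>The domain of a bundle chart consists of the tangent vectors over \<open>fst c\<close>.
  Since \<open>\<xi>\<close> maps into the carrier of the bundle, its values are tangent, so its
  representative is defined on the whole image of \<open>c\<close>, and \<open>vf_coord\<close> is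
  the second component.\<close>

lemma smooth_vf_coord:
  assumes M: "smooth_manifold M" and \<xi>: "smooth_vector_field M \<xi>" and c: "c \<in> M"
  shows "smooth_on (snd c ` fst c) (vf_coord \<xi> c)"
proof -
  have sm: "smooth_map M (tangent_bundle M) \<xi>" and fst_\<xi>: "fst (\<xi> p) = p" for p
    using \<xi> unfolding smooth_vector_field_def by (auto simp: fun_eq_iff)
  have "snd (\<xi> p) \<in> tangent_space M p" for p
  proof -
    have "\<xi> p \<in> carrier_of (tangent_bundle M)"
      using sm M unfolding smooth_map_def smooth_manifold_def by auto
    then obtain d where "\<xi> p \<in> Sigma (fst d) (tangent_space M)"
      by (auto simp: carrier_of_def tangent_bundle_def tangent_chart_def)
    then show ?thesis
      using fst_\<xi>[of p] by (metis mem_Sigma_iff prod.collapse)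
  qed
  then have "fst c \<inter> \<xi> -` fst (tangent_chart M c) = fst c"
    using fst_\<xi> by (auto simp: tangent_chart_def mem_Times_iff Sigma_def) (metis prod.collapse)
  moreover have "tangent_chart M c \<in> tangent_bundle M"
    using c by (simp add: tangent_bundle_def)
  ultimately have "smooth_on (snd c ` fst c) (snd (tangent_chart M c) \<circ> \<xi> \<circ> chart_inv c)"
    using sm c unfolding smooth_map_def by metis
  from smooth_on_compose[OF open_chart_image[OF M c] open_UNIV smooth_on_bounded_linear[OF open_UNIV bounded_linear_snd] this]
  show ?thesis
    by (simp add: tangent_chart_def vf_coord_def[abs_def] case_prod_beta' o_def)
qed

lemma integral_curve_coord:
  assumes "smooth_manifold M" "integral_curve M \<xi> \<gamma>" "c \<in> M" "\<gamma> t \<in> fst c"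
  shows "((\<lambda>t. snd c (\<gamma> t)) has_vector_derivative vf_coord \<xi> c (snd c (\<gamma> t))) (at t)"
  using assms unfolding integral_curve_iff vf_coord_def by (simp add: chart_inv_left o_def)

text \<open>The set of times of agreement is closed because the manifold is Hausdorff, and open by
  Gronwall's inequality in a chart; the real line is connected.\<close>

lemma integral_curve_unique:
  assumes M: "smooth_manifold M" and \<xi>: "smooth_vector_field M \<xi>"
    and \<gamma>: "integral_curve M \<xi> \<gamma>" and \<beta>: "integral_curve M \<xi> \<beta>" and eq0: "\<gamma> 0 = \<beta> 0"
  shows "\<gamma> = \<beta>"
proof -
  have cont: "isCont \<gamma> t" "isCont \<beta> t" for t
    using \<gamma> \<beta> by (auto simp: integral_curve_iff)
  let ?E = "{t. \<gamma> t = \<beta> t}"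
  have "open ?E"
    unfolding open_contains_ball
  proof
    fix t0 assume "t0 \<in> ?E"
    then have t0: "\<gamma> t0 = \<beta> t0" by simp
    obtain c where c: "c \<in> M" "\<gamma> t0 \<in> fst c" using chart_around[OF M] .
    obtain r K L where r: "r > 0" "K > 0" "L \<ge> 0" "cball (snd c (\<gamma> t0)) r \<subseteq> snd c ` fst c"
      and "\<And>x. x \<in> cball (snd c (\<gamma> t0)) r \<Longrightarrow> norm (vf_coord \<xi> c x) \<le> K"
      and lip: "\<And>x y. x \<in> cball (snd c (\<gamma> t0)) r \<Longrightarrow> y \<in> cball (snd c (\<gamma> t0)) r \<Longrightarrow>
        norm (vf_coord \<xi> c x - vf_coord \<xi> c y) \<le> L * norm (x - y)"
      using smooth_on_locally_bounded_Lipschitz[OF open_chart_image[OF M c(1)] smooth_vf_coord[OF M \<xi> c(1)] imageI[OF c(2)]]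
      by blast
    define N where "N = fst c \<inter> snd c -` ball (snd c (\<gamma> t0)) r"
    have N: "open N" "\<gamma> t0 \<in> N" "\<beta> t0 \<in> N"
      unfolding N_def using c r t0 open_chart_preimage[OF M c(1) open_ball] by auto
    have "open (\<gamma> -` N \<inter> \<beta> -` N)"
      using cont N(1) by (intro open_Int open_vimage continuous_at_imp_continuous_on) auto
    then obtain d where d: "d > 0" "ball t0 d \<subseteq> \<gamma> -` N \<inter> \<beta> -` N"
      using N openE by blast
    have "\<gamma> t = \<beta> t" if "t \<in> ball t0 d" for t
    proof -
      have seg: "\<gamma> s \<in> N" "\<beta> s \<in> N" if "s \<in> closed_segment t0 t" for s
      proof -
        have "closed_segment t0 t \<subseteq> ball t0 d"
          using \<open>t \<in> ball t0 d\<close> d(1) by (intro closed_segment_subset) auto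
        with d(2) that show "\<gamma> s \<in> N" "\<beta> s \<in> N" by blast+
      qed
      have "norm (snd c (\<gamma> t) - snd c (\<beta> t)) \<le> (norm (snd c (\<gamma> t0) - snd c (\<beta> t0)) + 0) * exp ((L + 1) * \<bar>t - t0\<bar>)"
      proof (rule norm_le_gronwall[OF r(3) order_refl])
        fix s assume "s \<in> closed_segment t0 t"
        note s = seg[OF this]
        show "((\<lambda>t. snd c (\<gamma> t) - snd c (\<beta> t)) has_vector_derivative
            vf_coord \<xi> c (snd c (\<gamma> s)) - vf_coord \<xi> c (snd c (\<beta> s))) (at s)"
          using s by (intro has_vector_derivative_diff integral_curve_coord[OF M _ c(1)] \<gamma> \<beta>) (auto simp: N_def)
        show "norm (vf_coord \<xi> c (snd c (\<gamma> s)) - vf_coord \<xi> c (snd c (\<beta> s))) \<le>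
            L * norm (snd c (\<gamma> s) - snd c (\<beta> s)) + 0"
          using s lip by (simp add: N_def)
      qed
      then have "snd c (\<gamma> t) = snd c (\<beta> t)" using t0 by simp
      moreover have "\<gamma> t \<in> fst c" "\<beta> t \<in> fst c"
        using seg[of t] by (auto simp: N_def)
      ultimately show ?thesis
        by (metis chart_inv_left[OF M c(1)])
    qed
    then show "\<exists>e>0. ball t0 e \<subseteq> ?E" using d(1) by blast
  qed
  moreover have "closed ?E"
    using cont by (intro closed_Collect_eq continuous_at_imp_continuous_on) auto
  ultimately have "?E = UNIV"
    using clopen[of ?E] eq0 by auto
  then show ?thesis by auto
qed

text \<open>Both sides, as functions of \<open>t\<close>, are integral curves starting at
  \<open>\<Phi> (p, s)\<close>.\<close>

lemma flow_of_add:
  assumes M: "smooth_manifold M" and \<xi>: "smooth_vector_field M \<xi>" and \<Phi>: "flow_of M \<xi> \<Phi>"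
  shows "\<Phi> (p, s + t) = \<Phi> (\<Phi> (p, s), t)"
proof -
  have "(\<lambda>t. \<Phi> (p, s + t)) = (\<lambda>t. \<Phi> (\<Phi> (p, s), t))"
    using \<Phi> integral_curve_shift[of M \<xi> "\<lambda>t. \<Phi> (p, t)" s]
    by (intro integral_curve_unique[OF M \<xi>]) (auto simp: flow_of_def)
  then show ?thesis by (rule fun_cong)
qed

text \<open>The speed bound is available only inside the chart, and a priori the curve could leave
  the chart domain at the very moment it leaves the ball. The closed coordinate ball is compact,
  hence closed in the Hausdorff manifold, so at the first exit time the curve is still in the chart,
  where it has travelled less than \<open>r / 2\<close>.\<close>

lemma curve_stays_in_ball_nonneg:
  fixes \<gamma> :: "real \<Rightarrow> 'a::{t2_space, second_countable_topology}"
  assumes M: "smooth_manifold M" and c: "c \<in> M" and r: "cball x0 r \<subseteq> snd c ` fst c" and K: "0 \<le> K"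
    and cont: "\<And>t. isCont \<gamma> t"
    and der: "\<And>t. \<gamma> t \<in> fst c \<Longrightarrow> ((\<lambda>t. snd c (\<gamma> t)) has_vector_derivative w t) (at t)"
    and w: "\<And>t. \<gamma> t \<in> fst c \<Longrightarrow> snd c (\<gamma> t) \<in> cball x0 r \<Longrightarrow> norm (w t) \<le> K"
    and start: "\<gamma> 0 \<in> fst c" "snd c (\<gamma> 0) \<in> ball x0 (r / 2)" and t: "0 \<le> t" "t * K < r / 2"
  shows "\<gamma> t \<in> fst c \<and> snd c (\<gamma> t) \<in> ball x0 r"
proof (rule ccontr)
  assume contra: "\<not> ?thesis"
  have "r > 0" using start(2) by (smt (verit) mem_ball zero_le_dist field_sum_of_halves)
  define N where "N = fst c \<inter> snd c -` ball x0 r"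
  define C where "C = chart_inv c ` cball x0 r"
  have N: "open N" unfolding N_def by (rule open_chart_preimage[OF M c open_ball])
  have "compact C" unfolding C_def
    using continuous_on_subset[OF continuous_on_chart_inv[OF M c] r] by (intro compact_continuous_image compact_cball)
  then have C: "closed C" by (rule compact_imp_closed)
  have NC: "N \<subseteq> C"
  proof
    fix p assume "p \<in> N"
    then show "p \<in> C"
      unfolding N_def C_def by (intro image_eqI[of _ _ "snd c p"]) (auto simp: chart_inv_left[OF M c])
  qed
  have C_in: "p \<in> fst c" "snd c p \<in> cball x0 r" if "p \<in> C" for p
    using that r smooth_manifold_chart[OF M c] unfolding C_def by auto
  let ?S = "{0..t} \<inter> \<gamma> -` (- N)"
  have cont': "continuous_on S \<gamma>" for S
    using cont by (auto intro: continuous_at_imp_continuous_on)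
  have "closed ?S"
    using N cont' by (intro continuous_closed_preimage) auto
  then have "compact ?S"
    by (metis compact_Int_closed compact_Icc inf.idem inf_assoc)
  moreover have "t \<in> ?S"
    using contra t by (auto simp: N_def)
  \<comment> \<open>\<open>m\<close> is the first exit time; it exists because the exit times form a
    nonempty compact set.\<close>
  ultimately obtain m where m: "m \<in> ?S" "\<And>s. s \<in> ?S \<Longrightarrow> m \<le> s"
    using compact_attains_inf[of ?S] by blast
  have "\<gamma> 0 \<in> N"
    using start \<open>r > 0\<close> by (auto simp: N_def)
  then have "m \<noteq> 0" using m by auto
  then have "m > 0" using m(1) by auto
  have "\<gamma> s \<in> N" if "s \<in> {0..<m}" for s
    using m that by (metis ComplI IntI atLeastAtMost_iff atLeastLessThan_iff dual_order.strict_trans1 less_le_not_le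
        order_less_imp_le vimageI2 IntD1)
  then have "\<gamma> ` {0..<m} \<subseteq> C" using NC by auto
  \<comment> \<open>Closedness of \<open>C\<close> carries membership over to the exit time
    itself.\<close>
  then have "\<gamma> ` closure {0..<m} \<subseteq> C"
    by (intro image_closure_subset C cont')
  then have in_C: "\<gamma> s \<in> C" if "s \<in> {0..m}" for s
    using that \<open>m > 0\<close> by auto
  have "norm (snd c (\<gamma> m) - snd c (\<gamma> 0)) \<le> K * m - K * 0"
  proof (rule differentiable_bound_general[OF \<open>m > 0\<close>])
    show "continuous_on {0..m} (\<lambda>s. snd c (\<gamma> s))"
      using in_C C_in by (intro continuous_on_compose2[OF continuous_on_chart[OF M c] cont']) auto
    show "continuous_on {0..m} ((*) K)" by (intro continuous_intros)
    show "((*) K has_vector_derivative K) (at s)" for s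
      by (auto intro!: derivative_eq_intros)
    fix s assume "0 < s" "s < m"
    then have "\<gamma> s \<in> C" by (intro in_C) auto
    then show "((\<lambda>s. snd c (\<gamma> s)) has_vector_derivative w s) (at s)" "norm (w s) \<le> K"
      using C_in der w by auto
  qed
  also have "\<dots> \<le> t * K"
    using m(1) K by (auto simp: mult.commute intro: mult_left_mono)
  finally have "dist (snd c (\<gamma> 0)) (snd c (\<gamma> m)) < r / 2"
    using t by (simp add: dist_norm norm_minus_commute)
  then have "snd c (\<gamma> m) \<in> ball x0 r"
    using start(2) dist_triangle[of x0 "snd c (\<gamma> m)" "snd c (\<gamma> 0)"] by simp
  then have "\<gamma> m \<in> N"
    using C_in(1)[OF in_C[of m]] \<open>m > 0\<close> by (simp add: N_def)
  then show False using m(1) by simp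
qed

lemma curve_stays_in_ball:
  fixes \<gamma> :: "real \<Rightarrow> 'a::{t2_space, second_countable_topology}"
  assumes M: "smooth_manifold M" and c: "c \<in> M" and r: "cball x0 r \<subseteq> snd c ` fst c" and K: "0 \<le> K"
    and cont: "\<And>t. isCont \<gamma> t"
    and der: "\<And>t. \<gamma> t \<in> fst c \<Longrightarrow> ((\<lambda>t. snd c (\<gamma> t)) has_vector_derivative w t) (at t)"
    and w: "\<And>t. \<gamma> t \<in> fst c \<Longrightarrow> snd c (\<gamma> t) \<in> cball x0 r \<Longrightarrow> norm (w t) \<le> K"
    and start: "\<gamma> 0 \<in> fst c" "snd c (\<gamma> 0) \<in> ball x0 (r / 2)" and t: "\<bar>t\<bar> * K < r / 2"
  shows "\<gamma> t \<in> fst c \<and> snd c (\<gamma> t) \<in> ball x0 r"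
proof (cases "0 \<le> t")
  case True
  then show ?thesis
    using curve_stays_in_ball_nonneg[OF M c r K cont der w start] t by simp
next
  case False
  have "((\<lambda>t. snd c (\<gamma> (- t))) has_vector_derivative - w (- t)) (at t)" if "\<gamma> (- t) \<in> fst c" for t
  proof -
    have "(uminus has_vector_derivative (- 1 :: real)) (at t)"
      by (auto intro!: derivative_eq_intros)
    from vector_diff_chain_at[OF this der[OF that]] show ?thesis by (simp add: o_def)
  qed
  moreover have "isCont (\<lambda>t. \<gamma> (- t)) t" for t
    using cont by (intro isCont_o2[where f = uminus and g = \<gamma>]) auto
  ultimately show ?thesis
    using curve_stays_in_ball_nonneg[OF M c r K, of "\<lambda>t. \<gamma> (- t)" "\<lambda>t. - w (- t)" "- t"] w start t False by simp
qed

text \<open>In a chart the flow is the solution family of an autonomous equation whose parameter is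
  the initial point, so its initial values form the identity map.\<close>

lemma flow_smooth_local:
  fixes M :: "('a::{t2_space, second_countable_topology}, 'e::euclidean_space) atlas"
  assumes M: "smooth_manifold M" and \<xi>: "smooth_vector_field M \<xi>" and \<Phi>: "flow_of M \<xi> \<Phi>"
  obtains N e where "open N" "p0 \<in> N" "e > 0"
    "\<And>p t. p \<in> N \<Longrightarrow> \<bar>t\<bar> < e \<Longrightarrow> smooth_near (times_real M) M \<Phi> (p, t)"
proof -
  obtain c where c: "c \<in> M" "p0 \<in> fst c" using chart_around[OF M] .
  define x0 where "x0 = snd c p0"
  obtain r K L where r: "r > 0" "K > 0" "L \<ge> 0" "cball x0 r \<subseteq> snd c ` fst c"
    and K: "\<And>x. x \<in> cball x0 r \<Longrightarrow> norm (vf_coord \<xi> c x) \<le> K"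
    and lip: "\<And>x y. x \<in> cball x0 r \<Longrightarrow> y \<in> cball x0 r \<Longrightarrow>
      norm (vf_coord \<xi> c x - vf_coord \<xi> c y) \<le> L * norm (x - y)"
    using smooth_on_locally_bounded_Lipschitz[OF open_chart_image[OF M c(1)] smooth_vf_coord[OF M \<xi> c(1)], of x0] c(2)
    unfolding x0_def by blast
  \<comment> \<open>At speed at most \<open>K\<close>, covering the distance \<open>r / 2\<close>
    from the half ball to the boundary of the ball takes at least this time.\<close>
  define e where "e = r / (2 * K)"
  have e: "e > 0" using r by (simp add: e_def)
  have curve: "integral_curve M \<xi> (\<lambda>t. \<Phi> (p, t))" and \<Phi>0: "\<Phi> (p, 0) = p" for p
    using \<Phi> by (auto simp: flow_of_def)
  have stay: "\<Phi> (p, t) \<in> fst c \<and> snd c (\<Phi> (p, t)) \<in> ball x0 r"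
    if p: "p \<in> fst c" "snd c p \<in> ball x0 (r / 2)" and t: "\<bar>t\<bar> < e" for p t
  proof (rule curve_stays_in_ball[OF M c(1) r(4), of K])
    show "isCont (\<lambda>t. \<Phi> (p, t)) s" for s
      using curve by (auto simp: integral_curve_iff)
    show "((\<lambda>t. snd c (\<Phi> (p, t))) has_vector_derivative vf_coord \<xi> c (snd c (\<Phi> (p, s)))) (at s)"
      if "\<Phi> (p, s) \<in> fst c" for s
      by (rule integral_curve_coord[OF M curve c(1) that])
    show "\<bar>t\<bar> * K < r / 2"
      using t r by (simp add: e_def pos_less_divide_eq)
  qed (use p r K \<Phi>0 in auto)
  let ?W = "ball x0 (r / 2)" and ?I = "{-e<..<e}"
  define y where "y = (\<lambda>(x, t). snd c (\<Phi> (chart_inv c x, t)))"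
  have W_sub: "?W \<subseteq> snd c ` fst c"
    using r by (auto intro!: subsetD[OF r(4)])
  have W: "chart_inv c x \<in> fst c" "snd c (chart_inv c x) = x" if "x \<in> ?W" for x
    using that W_sub smooth_manifold_chart[OF M c(1)] by blast+
  have stay': "\<Phi> (chart_inv c x, t) \<in> fst c" "y (x, t) \<in> ball x0 r" if "x \<in> ?W" "t \<in> ?I" for x t
    using stay[of "chart_inv c x" t] W that by (auto simp: y_def)
  have ode: "parametric_ode ?W e (ball x0 r) (\<lambda>(x, t, u). vf_coord \<xi> c u) L y"
  proof
    show "((\<lambda>t. y (x, t)) has_vector_derivative (\<lambda>(x, t, u). vf_coord \<xi> c u) (x, t, y (x, t))) (at t)"
      if "x \<in> ?W" "t \<in> ?I" for x t
      using integral_curve_coord[OF M curve c(1) stay'(1)[OF that]] by (simp add: y_def)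
  qed (use r lip stay' in auto)
  have o: "open (?W \<times> ?I \<times> ball x0 r)" by (intro open_Times) auto
  have "smooth_on (?W \<times> ?I \<times> ball x0 r) (\<lambda>q. vf_coord \<xi> c (snd (snd q)))"
    using r(4) by (intro smooth_on_compose[OF o open_chart_image[OF M c(1)] smooth_vf_coord[OF M \<xi> c(1)]]
        smooth_on_bounded_linear o bounded_linear_compose[OF bounded_linear_snd bounded_linear_snd]) auto
  moreover have "smooth_on ?W (\<lambda>x. y (x, 0))"
    by (rule smooth_on_cong[OF open_ball smooth_on_ident[OF open_ball]]) (simp add: y_def \<Phi>0 W)
  ultimately have sm: "smooth_on (?W \<times> ?I) y"
    by (intro parametric_ode_smooth_on[OF ode]) (simp_all add: case_prod_beta')
  define N where "N = fst c \<inter> snd c -` ?W"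
  have N: "open N" "p0 \<in> N"
    unfolding N_def using c r by (auto intro!: open_chart_preimage[OF M c(1)] simp: x0_def)
  let ?c = "(fst c \<times> UNIV, \<lambda>(p, t). (snd c p, t)) :: ('a \<times> real, 'e \<times> real) chart"
  have tc: "?c \<in> times_real M" using c by (auto simp: times_real_eq)
  have "smooth_near (times_real M) M \<Phi> (p, t)" if "p \<in> N" "\<bar>t\<bar> < e" for p t
  proof (rule smooth_nearI[OF smooth_manifold_times_real[OF M] tc c(1), of "N \<times> ?I" _ _ y])
    show "open (N \<times> ?I)" by (intro open_Times N) auto
    show "(p, t) \<in> N \<times> ?I" using that by auto
    show "\<Phi> ` (N \<times> ?I) \<subseteq> fst c" using stay by (auto simp: N_def)
    show "smooth_on (snd ?c ` (N \<times> ?I)) y"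
      by (rule smooth_on_subset[OF sm]) (auto simp: N_def)
    show "snd c (\<Phi> q) = y (snd ?c q)" if "q \<in> N \<times> ?I" for q
      using that by (auto simp: y_def N_def chart_inv_left[OF M c(1)])
  qed (auto simp: N_def)
  with N e show thesis by (rule that)
qed

text \<open>Near \<open>(p, t)\<close> the flow is the time \<open>t\<close> map after the flow near
  \<open>(p, 0)\<close>. The time \<open>t\<close> map is itself an iterate of a flow map at a time
  below \<open>\<epsilon>\<close>, hence smooth.\<close>

theorem flow_smooth:
  fixes M :: "('a::{t2_space, second_countable_topology}, 'e::euclidean_space) atlas"
  assumes "closed_smooth_manifold M" and \<xi>: "smooth_vector_field M \<xi>" and \<Phi>: "flow_of M \<xi> \<Phi>"
  shows "smooth_map (times_real M) M \<Phi>"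
proof -
  have M: "smooth_manifold M" and comp: "compact (UNIV :: 'a set)"
    using assms(1) by (auto simp: closed_smooth_manifold_def)
  note T = smooth_manifold_times_real[OF M]
  have "\<exists>N e. open N \<and> p \<in> N \<and> e > 0 \<and> (\<forall>p\<in>N. \<forall>t. \<bar>t\<bar> < e \<longrightarrow> smooth_near (times_real M) M \<Phi> (p, t))" for p
    using flow_smooth_local[OF M \<xi> \<Phi>, of p] by metis
  then obtain N e where N: "\<And>p. open (N p)" "\<And>p. p \<in> N p" "\<And>p. e p > 0"
    "\<And>p q t. q \<in> N p \<Longrightarrow> \<bar>t\<bar> < e p \<Longrightarrow> smooth_near (times_real M) M \<Phi> (q, t)"
    by metis
  have "UNIV \<subseteq> (\<Union>p\<in>UNIV. N p)" using N(2) by blast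
  then obtain D where D: "finite D" "UNIV \<subseteq> (\<Union>p\<in>D. N p)"
    by (metis compactE_image[OF comp] N(1))
  \<comment> \<open>The element 1 keeps \<open>Min\<close> on a nonempty set whatever
    \<open>D\<close> is.\<close>
  define \<epsilon> where "\<epsilon> = Min (insert 1 (e ` D))"
  have \<epsilon>: "\<epsilon> > 0" "\<And>p. p \<in> D \<Longrightarrow> \<epsilon> \<le> e p"
    using D(1) N(3) by (auto simp: \<epsilon>_def)
  have near: "smooth_near (times_real M) M \<Phi> (q, t)" if "\<bar>t\<bar> < \<epsilon>" for q t
  proof -
    obtain p where "p \<in> D" "q \<in> N p" using D(2) by blast
    with \<epsilon>(2)[of p] that show ?thesis by (intro N(4)) auto
  qed
  note add = flow_of_add[OF M \<xi> \<Phi>]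
  have small: "smooth_near M M (\<lambda>p. \<Phi> (p, s)) p" if "\<bar>s\<bar> < \<epsilon>" for s p
    using smooth_near_compose[OF M T M smooth_near_slice[OF M] near[OF that]] .
  have mult: "smooth_near M M (\<lambda>p. \<Phi> (p, real n * s)) p" if "\<bar>s\<bar> < \<epsilon>" for s p n
  proof (induction n arbitrary: p)
    case 0
    then show ?case using small[of 0 p] \<epsilon> by simp
  next
    case (Suc n)
    have "(\<lambda>p. \<Phi> (p, real (Suc n) * s)) = (\<lambda>p. \<Phi> (\<Phi> (p, real n * s), s))"
      by (simp add: add[symmetric] algebra_simps)
    with smooth_near_compose[OF M M M Suc small[OF that]] show ?case by simp
  qed
  have slice: "smooth_near M M (\<lambda>p. \<Phi> (p, s)) p" for s p
  proof -
    obtain n where n: "\<bar>s\<bar> < real n * \<epsilon>"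
      using ex_less_of_nat_mult[OF \<epsilon>(1)] by blast
    then have "n > 0" by (cases n) auto
    then have "\<bar>s / real n\<bar> < \<epsilon>"
      using n by (simp add: pos_divide_less_eq mult.commute)
    from mult[OF this, of n p] show ?thesis using \<open>n > 0\<close> by simp
  qed
  have "smooth_near (times_real M) M \<Phi> (p, t)" for p t
  proof -
    \<comment> \<open>Translates time so that \<open>(p, t)\<close> becomes \<open>(p, 0)\<close>.
      In \<open>\<Phi> (\<Phi> (\<tau> q), t)\<close> the inner flow is near time 0 and the outer
      time is fixed.\<close>
    define \<tau> where "\<tau> = (\<lambda>(p :: 'a, s). (p, 1 * s + (- t)))"
    have "smooth_near (times_real M) M \<Phi> (\<tau> (p, t))"
      using near[of 0 p] \<epsilon> by (simp add: \<tau>_def)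
    from smooth_near_compose[OF T T M smooth_near_affine_time[OF M, of 1 "- t", folded \<tau>_def] this]
    have "smooth_near (times_real M) M (\<lambda>q. \<Phi> (\<tau> q)) (p, t)" .
    from smooth_near_compose[OF T M M this slice[of t]]
    have "smooth_near (times_real M) M (\<lambda>q. \<Phi> (\<Phi> (\<tau> q), t)) (p, t)" .
    moreover have "(\<lambda>q. \<Phi> (\<Phi> (\<tau> q), t)) = \<Phi>"
      by (auto simp: \<tau>_def add[symmetric] fun_eq_iff)
    ultimately show ?thesis by simp
  qed
  then show ?thesis by (auto simp: smooth_map_iff[OF T M])
qed

section \<open>Root systems\<close>

lemma zpow_0 [simp]: "zpow g 0 p = p" and zpow_1 [simp]: "zpow g 1 p = g p"
  by (simp_all add: zpow_def)

lemma zpow_plus_1: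
  assumes "bij g"
  shows "zpow g (m + 1) p = g (zpow g m p)"
proof (cases "m \<ge> 0")
  case True
  then show ?thesis by (simp add: zpow_def nat_add_distrib)
next
  case False
  define k where "k = nat (- m - 1)"
  have m: "m = - int k - 1" using False by (simp add: k_def)
  have "nat (- m) = Suc k" "nat (- (m + 1)) = k" using m by simp_all
  \<comment> \<open>Between \<open>m\<close> and \<open>m + 1\<close> the definition of
    \<open>zpow\<close> switches branches only for \<open>m = -1\<close>, where the new exponent is
    0.\<close>
  moreover have "k = 0" if "m + 1 \<ge> 0" using that False by (simp add: k_def)
  ultimately show ?thesis
    using False by (auto simp: zpow_def surj_f_inv_f[OF bij_is_surj[OF assms]])
qed

text \<open>Induction on \<open>n\<close> in both directions; on the way down the rule for one more
  factor is used backwards, by injectivity of \<open>g\<close>.\<close>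

lemma zpow_add:
  assumes "bij g"
  shows "zpow g (m + n) p = zpow g n (zpow g m p)"
proof (induction n rule: int_induct[where k = 0])
  case base
  then show ?case by simp
next
  case (step1 n)
  then show ?case
    using zpow_plus_1[OF assms, of "m + n" p] zpow_plus_1[OF assms, of n "zpow g m p"] by (simp add: add.assoc)
next
  case (step2 n)
  have "g (zpow g (m + (n - 1)) p) = g (zpow g (n - 1) (zpow g m p))"
    using zpow_plus_1[OF assms, of "m + (n - 1)" p] zpow_plus_1[OF assms, of "n - 1" "zpow g m p"] step2
    by (simp add: add.assoc)
  then show ?case
    using assms by (simp add: bij_is_inj inj_eq)
qed

section \<open>Continuous extensions from rational times\<close>

lemma continuous_eq_on_Rats:
  fixes f g :: "real \<Rightarrow> 'a::t2_space"
  assumes "continuous_on UNIV f" "continuous_on UNIV g" "\<And>t. t \<in> \<rat> \<Longrightarrow> f t = g t"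
  shows "f t = g t"
proof -
  have "closed {t. f t = g t}"
    by (rule closed_Collect_eq[OF assms(1,2)])
  then have "closure \<rat> \<subseteq> {t. f t = g t}"
    using assms(3) by (intro closure_minimal) auto
  then show ?thesis
    using Rats_closure_real by auto
qed

lemma Rats_eq_int_div_nat:
  fixes t :: real
  assumes "t \<in> \<rat>"
  obtains a :: int and b :: nat where "b > 0" "t = real_of_int a / real b"
proof -
  obtain a b :: int where "b > 0" "t = of_int a / of_int b"
    using assms by (auto elim: Rats_cases')
  then show thesis by (intro that[of "nat b" a]) auto
qed

lemma continuous_on_slice:
  assumes "continuous_on UNIV \<Psi>"
  shows "continuous_on UNIV (\<lambda>t. \<Psi> (p, t))"
  by (rule continuous_on_compose2[OF assms]) (auto intro!: continuous_intros)

lemma continuous_extension_unique: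
  fixes \<Psi> \<Psi>' :: "'a::t2_space \<times> real \<Rightarrow> 'a"
  assumes "continuous_extension g \<Psi>" "continuous_extension g \<Psi>'"
  shows "\<Psi> = \<Psi>'"
proof
  fix x :: "'a \<times> real"
  obtain p t where x: "x = (p, t)" by (cases x)
  have "\<Psi> (p, t) = \<Psi>' (p, t)"
  proof (rule continuous_eq_on_Rats)
    show "continuous_on UNIV (\<lambda>t. \<Psi> (p, t))" "continuous_on UNIV (\<lambda>t. \<Psi>' (p, t))"
      using assms by (auto simp: continuous_extension_def intro: continuous_on_slice)
    fix t :: real assume "t \<in> \<rat>"
    then obtain a b where "b > 0" "t = real_of_int a / real b" by (rule Rats_eq_int_div_nat)
    then show "\<Psi> (p, t) = \<Psi>' (p, t)"
      using assms by (simp add: continuous_extension_def)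
  qed
  with x show "\<Psi> x = \<Psi>' x" by simp
qed

lemma continuous_extension_add:
  fixes \<Psi> :: "'a::t2_space \<times> real \<Rightarrow> 'a"
  assumes ext: "continuous_extension g \<Psi>" and bij: "\<And>b. b > 0 \<Longrightarrow> bij (g b)"
  shows "\<Psi> (p, s + t) = \<Psi> (\<Psi> (p, s), t)"
proof -
  have cont: "continuous_on UNIV \<Psi>"
    and val: "\<And>a b p. b > 0 \<Longrightarrow> \<Psi> (p, real_of_int a / real b) = zpow (g b) a p"
    using ext by (auto simp: continuous_extension_def)
  have rat: "\<Psi> (p, s + t) = \<Psi> (\<Psi> (p, s), t)" if s: "s \<in> \<rat>" and t: "t \<in> \<rat>" for s t
  proof -
    obtain a b where s: "b > 0" "s = real_of_int a / real b" using s by (rule Rats_eq_int_div_nat)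
    obtain c d where t: "d > 0" "t = real_of_int c / real d" using t by (rule Rats_eq_int_div_nat)
    have "s = real_of_int (a * int d) / real (b * d)" "t = real_of_int (c * int b) / real (b * d)"
      "s + t = real_of_int (a * int d + c * int b) / real (b * d)" "b * d > 0"
      using s t by (simp_all add: field_simps)
    then show ?thesis
      using zpow_add[OF bij[of "b * d"]] by (simp only: val)
  qed
  have c1: "continuous_on UNIV (\<lambda>s. \<Psi> (p, s + t))" for t
    by (rule continuous_on_compose2[OF cont]) (auto intro!: continuous_intros)
  have c2: "continuous_on UNIV (\<lambda>s. \<Psi> (\<Psi> (p, s), t))" for t
    by (rule continuous_on_compose2[OF cont]) (auto intro!: continuous_intros continuous_on_slice[OF cont])
  \<comment> \<open>Density is used for one time variable after the other: here \<open>s\<close>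
    varies while \<open>t\<close> is rational, and afterwards \<open>t\<close> varies with
    \<open>s\<close> fixed.\<close>
  have half: "\<Psi> (p, s + t) = \<Psi> (\<Psi> (p, s), t)" if "t \<in> \<rat>" for s t
    using continuous_eq_on_Rats[OF c1 c2 rat[OF _ that]] .
  have c3: "continuous_on UNIV (\<lambda>t. \<Psi> (p, s + t))"
    by (rule continuous_on_compose2[OF cont]) (auto intro!: continuous_intros)
  show ?thesis
    using continuous_eq_on_Rats[OF c3 continuous_on_slice[OF cont] half] .
qed

text \<open>With flow maps as roots, every algebraic clause of \<open>root_system\<close> becomes an
  identity between times: compositions add times and powers multiply them.\<close>

lemma flow_smoothly_rootable:
  fixes M :: "('a::{t2_space, second_countable_topology}, 'e::euclidean_space) atlas"
  assumes closed: "closed_smooth_manifold M" and \<xi>: "smooth_vector_field M \<xi>" and \<Phi>: "flow_of M \<xi> \<Phi>"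
  shows "smoothly_rootable M (\<lambda>p. \<Phi> (p, 1))"
proof -
  have M: "smooth_manifold M"
    using closed by (simp add: closed_smooth_manifold_def)
  note T = smooth_manifold_times_real[OF M]
  have sm: "smooth_map (times_real M) M \<Phi>"
    by (rule flow_smooth[OF closed \<xi> \<Phi>])
  then have near: "smooth_near (times_real M) M \<Phi> q" for q
    unfolding smooth_map_iff[OF T M] by blast
  have cont: "continuous_on UNIV \<Phi>"
    by (rule smooth_map_continuous_on[OF T M sm])
  define \<phi> where "\<phi> s p = \<Phi> (p, s)" for s p
  have \<phi>0: "\<phi> 0 p = p" for p
    using \<Phi> by (simp add: flow_of_def \<phi>_def)
  have add: "\<phi> s (\<phi> t p) = \<phi> (s + t) p" for s t p
    using flow_of_add[OF M \<xi> \<Phi>, of p t s] by (simp add: \<phi>_def add.commute)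
  have bij: "bij (\<phi> s)" for s
    by (rule o_bij[of "\<phi> (- s)"]) (auto simp: fun_eq_iff add \<phi>0)
  have inv: "inv (\<phi> s) = \<phi> (- s)" for s
    by (rule inv_equality) (auto simp: add \<phi>0)
  have funpow: "(\<phi> s ^^ n) p = \<phi> (real n * s) p" for s n p
    by (induction n) (auto simp: \<phi>0 add algebra_simps)
  have zpow: "zpow (\<phi> s) a p = \<phi> (real_of_int a * s) p" for s a p
    by (auto simp: zpow_def funpow inv)
  have \<phi>_smooth: "smooth_map M M (\<phi> s)" for s
    unfolding smooth_map_iff[OF M M] \<phi>_def[abs_def]
    using smooth_near_compose[OF M T M smooth_near_slice[OF M] near] by blast
  have diffeo: "self_diffeomorphism M (\<phi> s)" for s
    by (simp add: self_diffeomorphism_def bij inv \<phi>_smooth)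
  have isotopic: "isotopic M id (\<phi> s)" for s
    unfolding isotopic_def
  proof (intro exI conjI allI ballI)
    \<comment> \<open>Rescaled time runs along the flow from the identity to
      \<open>\<phi> s\<close>; the summand 0 matches the affine form of
      \<open>smooth_near_affine_time\<close>.\<close>
    define H where "H q = \<Phi> (case q of (p, t) \<Rightarrow> (p, s * t + 0))" for q
    show "smooth_map (times_real M) M H"
      unfolding smooth_map_iff[OF T M] H_def[abs_def]
      using smooth_near_compose[OF T T M smooth_near_affine_time[OF M] near] by blast
    show "self_diffeomorphism M (\<lambda>p. H (p, t))" for t
      using diffeo[of "s * t"] by (simp add: H_def \<phi>_def[abs_def])
    show "H (p, 0) = id p" "H (p, 1) = \<phi> s p" for p
      using \<phi>0[of p] by (simp_all add: H_def \<phi>_def)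
  qed
  define g where "g b = \<phi> (1 / real b)" for b :: nat
  have "root_system M (\<phi> 1) g"
    unfolding root_system_def
  proof (intro conjI allI impI)
    show "self_diffeomorphism M (g b)" "isotopic M id (g b)" for b
      by (simp_all add: g_def diffeo isotopic)
    show "g b ^^ b = \<phi> 1" if "b > 0" for b
      using that by (simp add: fun_eq_iff g_def funpow)
    \<comment> \<open>In terms of times, commutativity is
      \<open>1 / b1 + 1 / b2 = (b1 + b2) / (b1 * b2)\<close>.\<close>
    show "g b1 (g b2 p) = (g (b1 * b2) ^^ (b1 + b2)) p" "(g (b1 * b2) ^^ (b1 + b2)) p = g b2 (g b1 p)"
      if "b1 > 0" "b2 > 0" for b1 b2 p
      using that by (simp_all add: g_def funpow add field_simps)
    show "zpow (g b) a = zpow (g (b div nat (gcd a (int b)))) (a div gcd a (int b))" if b: "b > 0" for a b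
    proof -
      \<comment> \<open>In terms of times, coherency is \<open>a / b = (a / d) / (b / d)\<close>;
        the work lies in converting between integer and natural division.\<close>
      define d where "d = gcd a (int b)"
      have d: "d > 0" "d dvd a" "d dvd int b" using b by (simp_all add: d_def)
      then obtain k l where k: "a = d * k" "int b = d * l" by (auto elim!: dvdE)
      have l: "l > 0" using d(1) b k(2) by (metis of_nat_0_less_iff zero_less_mult_pos)
      have "nat (int b div d) = nat (int b) div nat d"
        by (rule nat_div_distrib) simp
      moreover have "int b div d = l" using k(2) d(1) by simp
      ultimately have "b div nat d = nat l" by simp
      moreover have "a div d = k" using k d by simp
      moreover have "real b = real_of_int d * real_of_int l"
        using k(2) by (metis of_int_mult of_int_of_nat_eq)
      ultimately show ?thesis
        unfolding d_def[symmetric] using d l k(1) by (simp add: fun_eq_iff g_def zpow)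
    qed
    show "(\<lambda>b. g b p) \<longlonglongrightarrow> p" for p
    proof -
      have "isCont (\<lambda>t. \<Phi> (p, t)) 0"
        using continuous_on_slice[OF cont] by (simp add: continuous_on_eq_continuous_at)
      then have "(\<lambda>b. \<Phi> (p, 1 / real b)) \<longlonglongrightarrow> \<Phi> (p, 0)"
        by (rule isCont_tendsto_compose[OF _ lim_1_over_n])
      then show ?thesis
        using \<phi>0[of p] by (simp add: g_def \<phi>_def)
    qed
  qed
  moreover have "continuous_extension g \<Phi>"
    unfolding continuous_extension_def using cont by (auto simp: g_def zpow) (simp add: \<phi>_def)
  ultimately have "smoothly_rootable M (\<phi> 1)"
    using sm isotopic unfolding smoothly_rootable_def smooth_root_system_def by blast
  then show ?thesis by (simp add: \<phi>_def[abs_def])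
qed

section \<open>The vector field of a smooth action\<close>

lemma smooth_map_times_real_coord:
  fixes M :: "('a::{t2_space, second_countable_topology}, 'e::euclidean_space) atlas"
  assumes M: "smooth_manifold M" and \<Psi>: "smooth_map (times_real M) M \<Psi>" and c: "c \<in> M" and d: "d \<in> M"
  defines "S \<equiv> (\<lambda>(p, t). (snd c p, t)) ` ((fst c \<times> UNIV) \<inter> \<Psi> -` fst d)"
  shows "open S" "smooth_on S (\<lambda>(x, t). snd d (\<Psi> (chart_inv c x, t)))"
proof -
  let ?c = "(fst c \<times> UNIV, \<lambda>(p, t). (snd c p, t)) :: ('a \<times> real, 'e \<times> real) chart"
  have tc: "?c \<in> times_real M" using c by (auto simp: times_real_eq)
  have *: "open (snd ?c ` (fst ?c \<inter> \<Psi> -` fst d)) \<and>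
    smooth_on (snd ?c ` (fst ?c \<inter> \<Psi> -` fst d)) (snd d \<circ> \<Psi> \<circ> chart_inv ?c)"
    by (rule bspec[OF bspec[OF conjunct2[OF \<Psi>[unfolded smooth_map_def]] tc] d])
  then show "open S" by (simp add: S_def)
  show "smooth_on S (\<lambda>(x, t). snd d (\<Psi> (chart_inv c x, t)))"
    by (rule smooth_on_cong[OF \<open>open S\<close> conjunct2[OF *, unfolded fst_conv snd_conv, folded S_def]])
      (auto simp: S_def chart_inv_times_real[OF M c])
qed

text \<open>The component of \<open>\<xi>\<close> in a chart is a partial time derivative, at time
  0, of a coordinate form of \<open>\<Psi>\<close>, so it is smooth in the base point. The action
  property turns the velocity at time \<open>t\<close> into the velocity at time 0 of the curve
  starting at \<open>\<Psi> (p, t)\<close>.\<close>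

lemma smooth_action_flow_of:
  fixes M :: "('a::{t2_space, second_countable_topology}, 'e::euclidean_space) atlas"
  assumes M: "smooth_manifold M" and \<Psi>: "smooth_map (times_real M) M \<Psi>"
    and zero: "\<And>p. \<Psi> (p, 0) = p" and add: "\<And>p s t. \<Psi> (p, s + t) = \<Psi> (\<Psi> (p, s), t)"
  defines "\<xi> \<equiv> \<lambda>p. velocity M (\<lambda>t. \<Psi> (p, t)) 0"
  shows "smooth_vector_field M \<xi>" "flow_of M \<xi> \<Psi>"
proof -
  define G where "G c d = (\<lambda>(x, t). snd d (\<Psi> (chart_inv c x, t)))" for c d :: "('a, 'e) chart"
  define S where "S c d = (\<lambda>(p, t). (snd c p, t)) ` ((fst c \<times> UNIV) \<inter> \<Psi> -` fst d)" for c d :: "('a, 'e) chart"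
  have S: "open (S c d)" "smooth_on (S c d) (G c d)" if "c \<in> M" "d \<in> M" for c d
    using smooth_map_times_real_coord[OF M \<Psi> that] by (simp_all add: S_def G_def)
  have cont: "isCont (\<lambda>t. \<Psi> (p, t)) t" for p t
    using continuous_on_slice[OF smooth_map_continuous_on[OF smooth_manifold_times_real[OF M] M \<Psi>]]
    by (simp add: continuous_on_eq_continuous_at)
  have \<xi>: "fst (\<xi> p) = p" "snd (\<xi> p) c = (if c \<in> M \<and> p \<in> fst c then vector_derivative (\<lambda>t. snd c (\<Psi> (p, t))) (at 0) else 0)"
    for p c by (simp_all add: \<xi>_def velocity_def zero o_def)
  have in_S: "(snd c p, 0) \<in> S c d" if "p \<in> fst c" "p \<in> fst d" for c d p
    unfolding S_def using that zero by (intro image_eqI[of _ _ "(p, 0)"]) auto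
  have G_der: "((\<lambda>t. snd d (\<Psi> (p, t))) has_vector_derivative frechet_derivative (G c d) (at (snd c p, 0)) (0, 1)) (at 0)"
    if c: "c \<in> M" "p \<in> fst c" and d: "d \<in> M" "p \<in> fst d" for c d p
  proof -
    let ?D = "frechet_derivative (G c d) (at (snd c p, 0))"
    have D: "(G c d has_derivative ?D) (at (snd c p, 0))"
      by (rule smooth_on_has_derivative[OF S(2)[OF c(1) d(1)] in_S[OF c(2) d(2)]])
    have "((\<lambda>t. G c d (snd c p, t)) has_derivative (\<lambda>h. ?D (0, h))) (at 0)"
      using D by (intro has_derivative_compose[of "\<lambda>t. (snd c p, t)" "\<lambda>h. (0, h)" 0 UNIV "G c d" ?D])
        (auto intro!: derivative_eq_intros)
    also have "(\<lambda>h. ?D (0, h)) = (\<lambda>h. h *\<^sub>R ?D (0, 1))"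
    proof
      fix h :: real
      have "?D (0, h) = ?D (h *\<^sub>R (0, 1))" by simp
      also have "\<dots> = h *\<^sub>R ?D (0, 1)" by (rule linear_cmul[OF has_derivative_linear[OF D]])
      finally show "?D (0, h) = h *\<^sub>R ?D (0, 1)" .
    qed
    also have "(\<lambda>t. G c d (snd c p, t)) = (\<lambda>t. snd d (\<Psi> (p, t)))"
      using c by (simp add: G_def chart_inv_left[OF M])
    finally show ?thesis
      unfolding has_vector_derivative_def .
  qed
  \<comment> \<open>The charts \<open>c\<close> and \<open>d\<close> may differ, since smoothness of
    \<open>\<xi>\<close> is tested on all pairs of charts.\<close>
  have \<xi>_eq: "snd (\<xi> p) d = frechet_derivative (G c d) (at (snd c p, 0)) (0, 1)"
    if "c \<in> M" "p \<in> fst c" "d \<in> M" "p \<in> fst d" for c d p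
    using vector_derivative_at[OF G_der[OF that]] that by (simp add: \<xi>)
  have \<xi>_der: "((\<lambda>t. snd d (\<Psi> (p, t))) has_vector_derivative snd (\<xi> p) d) (at 0)"
    if "d \<in> M" "p \<in> fst d" for d p
    using G_der[OF that that] \<xi>_eq[OF that that] by simp
  show "flow_of M \<xi> \<Psi>"
    unfolding flow_of_def integral_curve_iff o_def
  proof (intro allI conjI ballI impI zero cont)
    show "((\<lambda>t. snd c (\<Psi> (p, t))) has_vector_derivative snd (\<xi> (\<Psi> (p, t))) c) (at t)"
      if "c \<in> M" "\<Psi> (p, t) \<in> fst c" for p c t
      using has_vector_derivative_shift[of "\<lambda>s. snd c (\<Psi> (p, t + s))" _ "- t" t] \<xi>_der[OF that]
      by (simp add: add)
  qed (auto simp: \<xi>)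
  \<comment> \<open>The transformation law is the chain rule: near time 0 the curve stays in the
    domain of \<open>c\<close>, where reading it in \<open>d\<close> amounts to reading it in
    \<open>c\<close> and changing coordinates.\<close>
  have tangent: "snd (\<xi> p) \<in> tangent_space M p" for p
    unfolding tangent_space_def
  proof (intro CollectI conjI allI impI ballI)
    show "snd (\<xi> p) c = 0" if "c \<notin> M \<or> p \<notin> fst c" for c
      using that by (auto simp: \<xi>)
    fix c d assume c: "c \<in> M" and d: "d \<in> M" and p: "p \<in> fst c \<and> p \<in> fst d"
    let ?D = "frechet_derivative (\<lambda>x. snd d (chart_inv c x)) (at (snd c p))"
    have "((\<lambda>x. snd d (chart_inv c x)) has_derivative ?D) (at (snd c p))"
      using p by (intro smooth_on_has_derivative[OF smooth_transition[OF M c d]]) auto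
    then have "((\<lambda>x. snd d (chart_inv c x)) has_derivative ?D) (at (snd c (\<Psi> (p, 0))))"
      by (simp only: zero)
    then have D: "((\<lambda>t. snd d (chart_inv c (snd c (\<Psi> (p, t))))) has_derivative (\<lambda>h. ?D (h *\<^sub>R snd (\<xi> p) c))) (at 0)"
      using \<xi>_der[of c p] c p unfolding has_vector_derivative_def
      by (intro has_derivative_compose[of "\<lambda>t. snd c (\<Psi> (p, t))" "\<lambda>h. h *\<^sub>R snd (\<xi> p) c" 0 UNIV "\<lambda>x. snd d (chart_inv c x)" ?D]) auto
    have "open ((\<lambda>t. \<Psi> (p, t)) -` fst c)"
      using cont by (intro open_vimage open_chart_domain[OF M c] continuous_at_imp_continuous_on) auto
    then have "((\<lambda>t. snd d (\<Psi> (p, t))) has_derivative (\<lambda>h. ?D (h *\<^sub>R snd (\<xi> p) c))) (at 0)"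
      by (rule has_derivative_transform_within_open[OF D]) (use p zero in \<open>auto simp: chart_inv_left[OF M c]\<close>)
    moreover have "((\<lambda>t. snd d (\<Psi> (p, t))) has_derivative (\<lambda>h. h *\<^sub>R snd (\<xi> p) d)) (at 0)"
      using \<xi>_der[OF d] p by (simp add: has_vector_derivative_def)
    ultimately have "(\<lambda>h. ?D (h *\<^sub>R snd (\<xi> p) c)) = (\<lambda>h. h *\<^sub>R snd (\<xi> p) d)"
      by (rule has_derivative_unique)
    from fun_cong[OF this, of 1]
    show "snd (\<xi> p) d = frechet_derivative (snd d \<circ> chart_inv c) (at (snd c p)) (snd (\<xi> p) c)"
      by (simp add: o_def)
  qed
  have \<xi>_pair: "\<xi> p = (p, snd (\<xi> p))" for p
    using \<xi>(1)[of p] by (metis prod.collapse)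
  have \<xi>_in: "\<xi> p \<in> fst (tangent_chart M d) \<longleftrightarrow> p \<in> fst d" for p d
    using tangent[of p] by (subst \<xi>_pair) (simp add: tangent_chart_def)
  have "smooth_map M (tangent_bundle M) \<xi>"
    unfolding smooth_map_def
  proof (intro conjI ballI)
    show "\<xi> ` carrier_of M \<subseteq> carrier_of (tangent_bundle M)"
      using \<xi>_in by (auto simp: carrier_of_def tangent_bundle_def)
    fix c d' assume c: "c \<in> M" and "d' \<in> tangent_bundle M"
    then obtain d where d: "d \<in> M" "d' = tangent_chart M d" by (auto simp: tangent_bundle_def)
    have dom: "fst c \<inter> \<xi> -` fst d' = fst c \<inter> fst d"
      by (simp only: set_eq_iff Int_iff vimage_eq \<xi>_in d(2) simp_thms)
    show o: "open (snd c ` (fst c \<inter> \<xi> -` fst d'))"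
      unfolding dom by (intro open_chart_image_open[OF M c] open_Int open_chart_domain[OF M] c d) auto
    have "smooth_on (snd c ` (fst c \<inter> fst d)) (\<lambda>x. frechet_derivative (G c d) (at (x, 0)) (0, 1))"
      by (rule smooth_on_compose[OF o[unfolded dom] S(1)[OF c d(1)] smooth_on_frechet_derivative[OF S(2)[OF c d(1)]]
            smooth_on_Pair[OF o[unfolded dom] smooth_on_ident smooth_on_const]]) (auto intro: in_S o[unfolded dom])
    from smooth_on_Pair[OF o[unfolded dom] smooth_transition[OF M c d(1)] this]
    show "smooth_on (snd c ` (fst c \<inter> \<xi> -` fst d')) (snd d' \<circ> \<xi> \<circ> chart_inv c)"
      unfolding dom
    proof (rule smooth_on_cong[OF o[unfolded dom]])
      fix x assume "x \<in> snd c ` (fst c \<inter> fst d)"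
      then obtain p where p: "x = snd c p" "p \<in> fst c" "p \<in> fst d" by auto
      have "(snd d' \<circ> \<xi> \<circ> chart_inv c) x = (snd d p, snd (\<xi> p) d)"
        using p by (simp add: chart_inv_left[OF M c] d(2) tangent_chart_def case_prod_beta' \<xi>(1))
      then show "(snd d (chart_inv c x), frechet_derivative (G c d) (at (x, 0)) (0, 1)) = (snd d' \<circ> \<xi> \<circ> chart_inv c) x"
        using p \<xi>_eq[OF c p(2) d(1) p(3)] by (simp add: chart_inv_left[OF M c])
    qed
  qed
  then show "smooth_vector_field M \<xi>"
    by (simp add: smooth_vector_field_def fun_eq_iff \<xi>(1))
qed

text \<open>A smooth root system only promises that some continuous extension is smooth; uniqueness
  of the extension transfers smoothness to the given \<open>\<Psi>\<close>.\<close>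

lemma smooth_root_system_flow_of:
  fixes M :: "('a::{t2_space, second_countable_topology}, 'e::euclidean_space) atlas"
  assumes M: "smooth_manifold M" and g: "smooth_root_system M f g" and ext: "continuous_extension g \<Psi>"
  defines "\<xi> \<equiv> \<lambda>p. velocity M (\<lambda>t. \<Psi> (p, t)) 0"
  shows "smooth_vector_field M \<xi>" "flow_of M \<xi> \<Psi>" "f = (\<lambda>p. \<Psi> (p, 1))"
proof -
  have root: "root_system M f g" using g by (simp add: smooth_root_system_def)
  obtain \<Psi>' where \<Psi>': "continuous_extension g \<Psi>'" "smooth_map (times_real M) M \<Psi>'"
    using g by (auto simp: smooth_root_system_def)
  have sm: "smooth_map (times_real M) M \<Psi>"
    using \<Psi>' continuous_extension_unique[OF ext \<Psi>'(1)] by simp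
  have bij: "bij (g b)" if "b > 0" for b
    using root that by (auto simp: root_system_def self_diffeomorphism_def)
  have val: "\<Psi> (p, real_of_int a / real b) = zpow (g b) a p" if "b > 0" for p a b
    using ext that by (simp add: continuous_extension_def)
  have zero: "\<Psi> (p, 0) = p" for p
    using val[of 1 p 0] by simp
  note * = smooth_action_flow_of[OF M sm zero continuous_extension_add[OF ext bij]]
  from * show "smooth_vector_field M \<xi>" "flow_of M \<xi> \<Psi>"
    unfolding \<xi>_def by auto
  have "g 1 ^^ 1 = f" using root unfolding root_system_def by (metis zero_less_one)
  then show "f = (\<lambda>p. \<Psi> (p, 1))"
    using val[of 1 _ 1] by (auto simp: fun_eq_iff)
qed

theorem theorem1p1:
  fixes M :: "('a::{t2_space, second_countable_topology}, real ^ 'n) atlas"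
    and f :: "'a \<Rightarrow> 'a"
  assumes "closed_smooth_manifold M"
    and "self_diffeomorphism M f"
  shows "((\<exists>\<xi> \<Phi>. smooth_vector_field M \<xi> \<and> flow_of M \<xi> \<Phi> \<and> f = (\<lambda>p. \<Phi> (p, 1)))
            \<longleftrightarrow> smoothly_rootable M f)
       \<and> (\<forall>g \<Psi>. smooth_root_system M f g \<and> continuous_extension g \<Psi> \<longrightarrow>
            (\<forall>\<xi>. smooth_vector_field M \<xi> \<and> flow_of M \<xi> \<Psi> \<longleftrightarrow>
                  \<xi> = (\<lambda>p. velocity M (\<lambda>t. \<Psi> (p, t)) 0)))"
proof -
  have M: "smooth_manifold M"
    using assms(1) by (simp add: closed_smooth_manifold_def)
  \<comment> \<open>A flow determines its field: its velocity at time 0 is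
    \<open>\<xi> (\<Psi> (p, 0))\<close>, and \<open>\<Psi> (p, 0) = p\<close>.\<close>
  have "\<xi> = (\<lambda>p. velocity M (\<lambda>t. \<Psi> (p, t)) 0)" if "flow_of M \<xi> \<Psi>" for \<xi> \<Psi>
    using that by (auto simp: flow_of_def integral_curve_def fun_eq_iff)
  moreover have "\<exists>\<xi> \<Phi>. smooth_vector_field M \<xi> \<and> flow_of M \<xi> \<Phi> \<and> f = (\<lambda>p. \<Phi> (p, 1))" if "smoothly_rootable M f"
  proof -
    obtain g \<Psi> where "smooth_root_system M f g" "continuous_extension g \<Psi>"
      using \<open>smoothly_rootable M f\<close> unfolding smoothly_rootable_def smooth_root_system_def by blast
    then show ?thesis
      using smooth_root_system_flow_of[OF M] by blast
  qed
  moreover have "smoothly_rootable M f" if "smooth_vector_field M \<xi>" "flow_of M \<xi> \<Phi>" "f = (\<lambda>p. \<Phi> (p, 1))" for \<xi> \<Phi>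
    using flow_smoothly_rootable[OF assms(1) that(1,2)] that(3) by simp
  ultimately show ?thesis
    using smooth_root_system_flow_of(1,2)[OF M] by blast
qed

end
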